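(* Let $G$ be a finite claw-free graph with vertex set $V$. Let $\mathbb{I}$ be an independent set of $G$ chosen uniformly at random from the collection of all independent sets of $G$, and let $\lambda=E|\mathbb{I}|$ be its average cardinality. Let $Q$ be a log-concave probability distribution on $\mathbb{N}=\{1,2,\ldots\}$ with $Q(1)>0$ and $\lambda Q(1)^2\ge 2Q(2)$. Let $\{X_i:i\in V\}$ be i.i.d. with law $Q$, independent of $\mathbb{I}$, and let $W=\sum_{i\in\mathbb{I}}X_i$ be the random weight of $\mathbb{I}$. Then $$H(W)\le H(C_Q\Pi_\lambda).$$
   Context: An independent set of a graph is a subset of its vertices (possibly empty) no two of which are joined by an edge. A graph is claw-free if it does not contain the complete bipartite graph $K_{1,3}$ as an induced subgraph. $H$ denotes discrete entropy: $H(P)=-\sum_xP(x)\log P(x)$ (natural logarithm, $0\log 0=0$), and $H(W)$ is the entropy of the law of $W$. A distribution $P$ on $\mathbb{Z}_+=\{0,1,\ldots\}$ is log-concave if its support is a (possibly infinite) interval of successive integers and $P(x)^2\ge P(x+1)P(x-1)$ for all $x\ge1$; a distribution on $\mathbb{N}$ is regarded as one on $\mathbb{Z}_+$ with zero mass at $0$. $\Pi_\lambda(x)=e^{-\lambda}\lambda^x/x!$ is the Poisson mass function, and $C_Q\Pi_\lambda(x)=\sum_{y\ge0}\Pi_\lambda(y)Q^{*y}(x)$ is the compound Poisson distribution, where $Q^{*y}$ is the $y$-fold convolution power of $Q$ and $Q^{*0}$ is the point mass at $0$. *)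

theory Defs
  imports
    "HOL-Probability.Probability"
    "Graph_Theory.Graph_Theory"
begin

text \<open>A finite simple undirected graph is an instance of the locale \<^locale>\<open>graph\<close>: a finite
  digraph with symmetric arcs, no loops and no parallel arcs.\<close>

definition claw_free :: "('a, 'b) pre_digraph \<Rightarrow> bool" where
  "claw_free G \<longleftrightarrow> \<not> (\<exists>H. induced_subgraph H G \<and> complete_bipartite_digraph 1 3 H)"

definition independent_sets :: "('a, 'b) pre_digraph \<Rightarrow> 'a set set" where
  "independent_sets G = {S. S \<subseteq> verts G \<and> (\<forall>u\<in>S. \<forall>v\<in>S. \<not> dominates G u v)}"

text \<open>Distributions on the nonnegative integers are represented by their mass functions.\<close>

definition log_concave :: "(nat \<Rightarrow> real) \<Rightarrow> bool" where
  "log_concave p \<longleftrightarrow>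
     (\<forall>i k. p i \<noteq> 0 \<and> p k \<noteq> 0 \<longrightarrow> {i..k} \<subseteq> {j. p j \<noteq> 0}) \<and>
     (\<forall>x\<ge>1. (p x)\<^sup>2 \<ge> p (x + 1) * p (x - 1))"

text \<open>For a mass function every summand below is nonnegative, so \<^const>\<open>ennreal\<close> does not truncate
  anything; a divergent series has the value \<open>\<infinity>\<close>.\<close>

definition mass_entropy :: "(nat \<Rightarrow> real) \<Rightarrow> ennreal" where
  "mass_entropy p = (\<Sum>x. ennreal (- (p x * ln (p x))))"

definition convolve :: "(nat \<Rightarrow> real) \<Rightarrow> (nat \<Rightarrow> real) \<Rightarrow> nat \<Rightarrow> real" where
  "convolve p q x = (\<Sum>k\<le>x. p k * q (x - k))"

primrec conv_power :: "(nat \<Rightarrow> real) \<Rightarrow> nat \<Rightarrow> nat \<Rightarrow> real" where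
  "conv_power q 0 = (\<lambda>x. if x = 0 then 1 else 0)"
| "conv_power q (Suc n) = convolve (conv_power q n) q"

text \<open>Unlike \<^const>\<open>poisson_pmf\<close>, which requires a positive rate, this includes rate \<open>0\<close>
  (the point mass at \<open>0\<close>).\<close>

definition poisson_mass :: "real \<Rightarrow> nat \<Rightarrow> real" where
  "poisson_mass l x = exp (- l) * l ^ x / fact x"

definition compound :: "(nat \<Rightarrow> real) \<Rightarrow> (nat \<Rightarrow> real) \<Rightarrow> nat \<Rightarrow> real" where
  "compound q p x = (\<Sum>y. p y * conv_power q y x)"

text \<open>\<^const>\<open>prob_space.indep_var\<close> requires both random variables to take values in the same
  type, so independence is stated here for the families of preimages, as in its definition.\<close>

definition independent_rvs ::
    "'w measure \<Rightarrow> 'a measure \<Rightarrow> ('w \<Rightarrow> 'a) \<Rightarrow> 'b measure \<Rightarrow> ('w \<Rightarrow> 'b) \<Rightarrow> bool" where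
  "independent_rvs M S X T Y \<longleftrightarrow>
     X \<in> measurable M S \<and> Y \<in> measurable M T \<and>
     prob_space.indep_set M
       {X -` A \<inter> space M | A. A \<in> sets S} {Y -` B \<inter> space M | B. B \<in> sets T}"

end

theory Submission
  imports Defs
begin

text \<open>If \<open>l = 0\<close>, the random set is almost surely empty and the weight is constant. Let \<open>l > 0\<close>, and write
\<open>r\<close> for the compound Poisson mass function and \<open>\<phi> y\<close> for the mean of \<open>- ln (r S)\<close>, where
\<open>S\<close> is a sum of \<open>y\<close> independent variables of law \<open>Q\<close>.

By the Gibbs inequality the entropy of the random weight is at most the mean of \<open>- ln r\<close> under
its law, which is the mean of \<open>\<phi>\<close> under the law of the cardinality of the random independent set.
The entropy of \<open>r\<close> itself is the mean of \<open>\<phi>\<close> under the Poisson law of rate \<open>l\<close>. So the claim follows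
once \<open>\<phi>\<close> is convex and the cardinality is below the Poisson variable of equal mean in the convex
order.

Convexity of \<open>\<phi>\<close> is inherited from convexity of \<open>- ln r\<close>, by adding two further independent
variables to a partial sum (\<open>nn_integral_iid_sum_convex\<close>). That \<open>r\<close> is log-concave
(\<open>compound_poisson_log_concave\<close>) comes from the linear recursion which \<open>r\<close> satisfies, by
induction through a quadratic identity (\<open>recursion_log_concave\<close>); the hypothesis
\<open>l * (pmf Q 1)\<^sup>2 \<ge> 2 * pmf Q 2\<close> is exactly its first instance
\<open>(r 1)\<^sup>2 \<ge> r 0 * r 2\<close>.

The convex order (\<open>log_concave_ratio_convex_order\<close>) holds because the mass function of the
cardinality divided by that of the Poisson law is log-concave: the set where the quotient is at
least \<open>1\<close> is an interval, and comparing \<open>\<phi>\<close> with its chord over that interval settles all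
signs. Log-concavity of the quotient means that the numbers \<open>i\<^sub>k\<close> of independent \<open>k\<close>-sets satisfy
\<open>(k + 1) * i\<^sub>k\<^sub>+\<^sub>1 * i\<^sub>k\<^sub>-\<^sub>1 \<le> k * (i\<^sub>k)\<^sup>2\<close> (\<open>level_ultra_log_concave\<close>). Here claw-freeness enters: the union
of two independent sets \<open>A\<close>, \<open>B\<close> induces a graph whose components are paths and even cycles, so
the numbers of vertices of \<open>A\<close> and \<open>B\<close> in a component differ by at most one, and exchanging \<open>A\<close> and
\<open>B\<close> inside single components gives a weighted correspondence from pairs of sizes
\<open>k + 1, k - 1\<close> to pairs of sizes \<open>k, k\<close>.\<close>

section \<open>Independent sets of a claw-free graph\<close>

text \<open>Three neighbours of one vertex inside an independent set would form a claw with it; this is the form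
in which claw-freeness enters the counting of independent sets.\<close>
locale claw_free_relation =
  fixes V :: "'a set" and E :: "'a \<Rightarrow> 'a \<Rightarrow> bool"
  assumes finite_V: "finite V"
    and E_sym: "E u v \<Longrightarrow> E v u"
    and few_neighbours:
      "\<lbrakk>v \<in> V; A \<subseteq> V; \<forall>u\<in>A. \<forall>w\<in>A. \<not> E u w\<rbrakk> \<Longrightarrow> card {a \<in> A. E v a} \<le> 2"
begin

definition indep :: "'a set set" where
  "indep = {S. S \<subseteq> V \<and> (\<forall>u\<in>S. \<forall>v\<in>S. \<not> E u v)}"

definition components :: "'a set \<Rightarrow> 'a set set" where
  "components U = (\<lambda>x. {y. (x, y) \<in> {(u, v). u \<in> U \<and> v \<in> U \<and> E u v}\<^sup>*}) ` U"

lemma indepD: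
  assumes "S \<in> indep"
  shows "S \<subseteq> V" "finite S" "\<And>u v. \<lbrakk>u \<in> S; v \<in> S\<rbrakk> \<Longrightarrow> \<not> E u v"
proof -
  show "S \<subseteq> V" using assms unfolding indep_def by blast
  then show "finite S" using finite_V by (rule finite_subset)
  show "\<And>u v. \<lbrakk>u \<in> S; v \<in> S\<rbrakk> \<Longrightarrow> \<not> E u v" using assms unfolding indep_def by blast
qed

lemma finite_indep: "finite indep"
proof (rule finite_subset)
  show "indep \<subseteq> Pow V" unfolding indep_def by blast
qed (simp add: finite_V)

lemma indep_subset: "\<lbrakk>S \<in> indep; T \<subseteq> S\<rbrakk> \<Longrightarrow> T \<in> indep"
  unfolding indep_def by blast

lemma component_subset:
  assumes "C \<in> components U" shows "C \<subseteq> U"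
proof
  fix y assume "y \<in> C"
  then obtain x where "x \<in> U" and xy: "(x, y) \<in> {(u, v). u \<in> U \<and> v \<in> U \<and> E u v}\<^sup>*"
    using assms unfolding components_def by blast
  from xy show "y \<in> U"
    by (cases rule: rtranclE) (use \<open>x \<in> U\<close> in auto)
qed

lemma Union_components: "\<Union> (components U) = U"
proof
  show "\<Union> (components U) \<subseteq> U" using component_subset by blast
  show "U \<subseteq> \<Union> (components U)" unfolding components_def by blast
qed

lemma component_closed:
  assumes C: "C \<in> components U" and uv: "u \<in> C" "v \<in> U" "E u v"
  shows "v \<in> C"
proof -
  let ?R = "{(u, v). u \<in> U \<and> v \<in> U \<and> E u v}"
  have "(u, v) \<in> ?R" using uv component_subset[OF C] by blast
  moreover obtain x where x: "C = {y. (x, y) \<in> ?R\<^sup>*}"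
    using C unfolding components_def by blast
  moreover have "(x, u) \<in> ?R\<^sup>*" using x uv by blast
  ultimately have "(x, v) \<in> ?R\<^sup>*" by (rule_tac rtrancl_into_rtrancl)
  then show ?thesis using x by blast
qed

lemma component_eq:
  assumes "C \<in> components U" "u \<in> C"
  shows "C = {y. (u, y) \<in> {(u, v). u \<in> U \<and> v \<in> U \<and> E u v}\<^sup>*}"
proof -
  let ?R = "{(u, v). u \<in> U \<and> v \<in> U \<and> E u v}"
  have "sym ?R" by (auto simp: sym_def E_sym)
  then have sym: "sym (?R\<^sup>*)" by (rule sym_rtrancl)
  obtain x where x: "C = {y. (x, y) \<in> ?R\<^sup>*}"
    using assms unfolding components_def by blast
  then have xu: "(x, u) \<in> ?R\<^sup>*" using assms(2) by blast
  then have ux: "(u, x) \<in> ?R\<^sup>*" using sym by (rule symD[rotated])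
  have "(x, y) \<in> ?R\<^sup>* \<longleftrightarrow> (u, y) \<in> ?R\<^sup>*" for y
    using rtrancl_trans[OF xu, of y] rtrancl_trans[OF ux, of y] by blast
  then show ?thesis unfolding x by (rule Collect_cong)
qed

lemma components_disjoint:
  assumes "C \<in> components U" "D \<in> components U" "C \<noteq> D"
  shows "C \<inter> D = {}"
proof (rule ccontr)
  assume "C \<inter> D \<noteq> {}"
  then obtain u where "u \<in> C" "u \<in> D" by blast
  then have "C = D"
    using component_eq[OF assms(1), of u] component_eq[OF assms(2), of u] by simp
  then show False using assms(3) by simp
qed

lemma component_connected:
  assumes C: "C \<in> components U" and S: "S \<subset> C" "S \<noteq> {}"
  obtains u v where "u \<in> S" "v \<in> C - S" "E u v"
proof -
  obtain s c where s: "s \<in> S" and c: "c \<in> C" "c \<notin> S" using S by blast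
  have "(s, c) \<in> {(u, v). u \<in> U \<and> v \<in> U \<and> E u v}\<^sup>*"
    (is "_ \<in> ?R\<^sup>*")
  proof -
    have "s \<in> C" using s S by blast
    from component_eq[OF C this] c show ?thesis by blast
  qed
  then have "c \<in> S \<or> (\<exists>u\<in>S. \<exists>v\<in>C - S. E u v)"
  proof (induction rule: rtrancl_induct)
    case (step y z)
    then show ?case
      using component_closed[OF C, of y z] S by blast
  qed (use s in simp)
  then show thesis using c that by blast
qed

lemma component_nonempty: "C \<in> components U \<Longrightarrow> C \<noteq> {}"
  unfolding components_def by blast

text \<open>A connected set of \<open>n\<close> vertices carries at least \<open>n - 1\<close> edges: it can be exhausted from one
vertex by adding neighbours of what is already there. Inside \<open>A \<union> B\<close> every edge joins \<open>A\<close> to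
\<open>B\<close>, so each is counted once when listed with its endpoint in \<open>B\<close> first.\<close>
lemma component_edges:
  fixes A B
  defines "F \<equiv> \<lambda>S. {(b, a). b \<in> B \<inter> S \<and> a \<in> A \<inter> S \<and> E b a}"
  assumes A: "A \<in> indep" and B: "B \<in> indep" and C: "C \<in> components (A \<union> B)"
  shows "card C \<le> card (F C) + 1"
proof -
  have CU: "C \<subseteq> A \<union> B" using component_subset[OF C] .
  have finC: "finite C" by (rule finite_subset[OF CU]) (simp add: indepD(2)[OF A] indepD(2)[OF B])
  have finF: "finite (F S)" if "S \<subseteq> C" for S
    proof (rule finite_subset)
    show "F S \<subseteq> S \<times> S" by (auto simp: F_def)
  qed (simp add: finite_subset[OF that finC])
  have "\<exists>S\<subseteq>C. card S = Suc n \<and> n \<le> card (F S)" if "Suc n \<le> card C" for n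
    using that
  proof (induction n)
    case 0
    then obtain x where "x \<in> C" using component_nonempty[OF C] by blast
    then show ?case by (intro exI[of _ "{x}"]) auto
  next
    case (Suc n)
    then obtain S where S: "S \<subseteq> C" "card S = Suc n" "n \<le> card (F S)" by auto
    have "S \<subset> C" "S \<noteq> {}" using S Suc.prems by auto
    then obtain u v where uv: "u \<in> S" "v \<in> C - S" "E u v"
      using component_connected[OF C] by blast
    have finS: "finite S" using finite_subset[OF S(1) finC] .
    have "\<exists>e. e \<in> F (insert v S) - F S"
    proof (cases "u \<in> A")
      case True
      then have "v \<in> B" using uv CU indepD(3)[OF A, of u v] by blast
      then have "(v, u) \<in> F (insert v S) - F S"
        using uv True E_sym by (auto simp: F_def)
      then show ?thesis by blast
    next
      case False
      then have "u \<in> B" using uv S CU by blast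
      moreover from this have "v \<in> A" using uv CU indepD(3)[OF B, of u v] by blast
      ultimately have "(u, v) \<in> F (insert v S) - F S"
        using uv by (auto simp: F_def)
      then show ?thesis by blast
    qed
    moreover have "F S \<subseteq> F (insert v S)" by (auto simp: F_def)
    ultimately have "F S \<subset> F (insert v S)" by blast
    then have "card (F S) < card (F (insert v S))"
      using finF[of "insert v S"] uv S by (intro psubset_card_mono) auto
    then show ?case
      using S uv finS by (intro exI[of _ "insert v S"]) auto
  qed
  moreover have "Suc (card C - 1) = card C"
    using component_nonempty[OF C] finC by (simp add: card_gt_0_iff)
  ultimately obtain S where S: "S \<subseteq> C" "card S = card C" "card C - 1 \<le> card (F S)"
    by (metis order_refl)
  then have "S = C" using card_subset_eq[OF finC] by blast
  then show ?thesis using S by simp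
qed

text \<open>A component has at least \<open>card C - 1\<close> edges, and each of its vertices in \<open>B\<close> lies on at most two
of them; hence \<open>card (A \<inter> C) + card (B \<inter> C) - 1 \<le> 2 * card (B \<inter> C)\<close> when \<open>A\<close> and \<open>B\<close> are disjoint
on \<open>C\<close>. A vertex common to \<open>A\<close> and \<open>B\<close> has no neighbour in \<open>A \<union> B\<close> and forms a component of its
own.\<close>
lemma component_balance:
  assumes A: "A \<in> indep" and B: "B \<in> indep" and C: "C \<in> components (A \<union> B)"
  shows "card (A \<inter> C) \<le> card (B \<inter> C) + 1"
proof (cases "A \<inter> B \<inter> C = {}")
  case False
  then obtain v where v: "v \<in> A" "v \<in> B" "v \<in> C" by blast
  have "C = {v}"
  proof (rule ccontr)
    assume "C \<noteq> {v}"
    then obtain w where "w \<in> C" "E v w"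
      using component_connected[OF C, of "{v}"] v by blast
    then show False
      using component_subset[OF C] v indepD(3)[OF A, of v w] indepD(3)[OF B, of v w] by blast
  qed
  then show ?thesis using v by simp
next
  case True
  note fin = indepD(2)[OF A] indepD(2)[OF B]
  let ?F = "{(b, a). b \<in> B \<inter> C \<and> a \<in> A \<inter> C \<and> E b a}"
  have "card ?F \<le> card (SIGMA b:B \<inter> C. {a \<in> A. E b a})"
    using fin by (intro card_mono finite_SigmaI) auto
  also have "\<dots> = (\<Sum>b\<in>B \<inter> C. card {a \<in> A. E b a})"
    using fin by (intro card_SigmaI) auto
  also have "\<dots> \<le> card (B \<inter> C) * 2"
  proof -
    have "card {a \<in> A. E b a} \<le> 2" if "b \<in> B \<inter> C" for b
      using that indepD[OF A] indepD(1)[OF B] by (intro few_neighbours) auto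
    from sum_bounded_above[of "B \<inter> C", OF this] show ?thesis by simp
  qed
  finally have "card ?F \<le> card (B \<inter> C) * 2" .
  moreover have "card C = card (A \<inter> C) + card (B \<inter> C)"
  proof -
    have "C = (A \<inter> C) \<union> (B \<inter> C)" using component_subset[OF C] by blast
    moreover have "(A \<inter> C) \<inter> (B \<inter> C) = {}" using True by blast
    ultimately show ?thesis using fin card_Un_disjoint[of "A \<inter> C" "B \<inter> C"] by simp
  qed
  ultimately show ?thesis
    using component_edges[OF A B C] by simp
qed

text \<open>For independent \<open>A\<close> and \<open>B\<close> these components are the paths that begin and end in \<open>A\<close>.\<close>
definition excess :: "'a set \<Rightarrow> 'a set \<Rightarrow> 'a set set" where
  "excess A B = {C \<in> components (A \<union> B). card (A \<inter> C) = card (B \<inter> C) + 1}"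

lemma finite_components: "finite U \<Longrightarrow> finite (components U)"
  by (simp add: components_def)

lemma finite_excess: "\<lbrakk>A \<in> indep; B \<in> indep\<rbrakk> \<Longrightarrow> finite (excess A B)"
  using finite_components[of "A \<union> B"] indepD(2) by (simp add: excess_def)

lemma card_by_components:
  assumes "finite A" "A \<subseteq> U" "finite U"
  shows "card A = (\<Sum>C\<in>components U. card (A \<inter> C))"
proof -
  have "A = (\<Union>C\<in>components U. A \<inter> C)"
    using assms Union_components[of U] by blast
  also have "card \<dots> = (\<Sum>C\<in>components U. card (A \<inter> C))"
    using assms components_disjoint[of _ U]
    by (intro card_UN_disjoint) (auto simp: finite_components)
  finally show ?thesis .
qed

text \<open>Each component contributes \<open>1\<close>, \<open>0\<close> or \<open>-1\<close> to \<open>card A - card B\<close>; the identity collects these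
contributions, written without subtraction.\<close>
lemma card_excess_balance:
  assumes A: "A \<in> indep" and B: "B \<in> indep"
  shows "card A + card (excess B A) = card B + card (excess A B)"
proof -
  let ?K = "components (A \<union> B)"
  have fin: "finite A" "finite B" "finite ?K"
    using indepD(2)[OF A] indepD(2)[OF B] by (auto simp: finite_components)
  have card_if: "card {C \<in> ?K. P C} = (\<Sum>C\<in>?K. if P C then 1 else 0)" for P
    using fin by (simp add: sum.If_cases Int_def)
  have "card A + card (excess B A)
      = (\<Sum>C\<in>?K. card (A \<inter> C) + (if card (B \<inter> C) = card (A \<inter> C) + 1 then 1 else 0))"
    using card_by_components[of A "A \<union> B"] fin
    by (simp add: excess_def card_if sum.distrib Un_commute[of B A])
  also have "\<dots> = (\<Sum>C\<in>?K. card (B \<inter> C) + (if card (A \<inter> C) = card (B \<inter> C) + 1 then 1 else 0))"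
  proof (rule sum.cong)
    fix C assume C: "C \<in> ?K"
    then have "card (A \<inter> C) \<le> card (B \<inter> C) + 1" "card (B \<inter> C) \<le> card (A \<inter> C) + 1"
      using component_balance[OF A B] component_balance[OF B A] by (auto simp: Un_commute)
    then show "card (A \<inter> C) + (if card (B \<inter> C) = card (A \<inter> C) + 1 then 1 else 0)
      = card (B \<inter> C) + (if card (A \<inter> C) = card (B \<inter> C) + 1 then 1 else 0)" by auto
  qed simp
  also have "\<dots> = card B + card (excess A B)"
    using card_by_components[of B "A \<union> B"] fin
    by (simp add: excess_def card_if sum.distrib)
  finally show ?thesis .
qed

lemma card_excess_le:
  assumes A: "A \<in> indep" and B: "B \<in> indep"
  shows "card (excess A B) \<le> card A"
proof -
  have ne: "A \<inter> C \<noteq> {}" if "C \<in> excess A B" for C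
    using that by (auto simp: excess_def)
  define f where "f C = (SOME x. x \<in> A \<inter> C)" for C
  have f: "f C \<in> A \<inter> C" if "C \<in> excess A B" for C
    using ne[OF that] unfolding f_def by (meson ex_in_conv someI_ex)
  have "inj_on f (excess A B)"
  proof (rule inj_onI)
    fix C D assume CD: "C \<in> excess A B" "D \<in> excess A B" "f C = f D"
    then have "C \<inter> D \<noteq> {}" using f[of C] f[of D] by auto
    then show "C = D" using components_disjoint CD by (auto simp: excess_def)
  qed
  then show ?thesis
    using f indepD(2)[OF A] by (intro card_inj_on_le[of f]) auto
qed

definition swap :: "'a set \<Rightarrow> 'a set \<Rightarrow> 'a set \<Rightarrow> 'a set" where
  "swap C A B = (A - C) \<union> (B \<inter> C)"

lemma swap_union: "swap C A B \<union> swap C B A = A \<union> B"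
  by (auto simp: swap_def)

lemma swap_swap: "swap C (swap C A B) (swap C B A) = A"
  by (auto simp: swap_def)

lemma swap_Int_self: "swap C A B \<inter> C = B \<inter> C"
  by (auto simp: swap_def)

lemma swap_Int_disjoint: "C \<inter> D = {} \<Longrightarrow> swap C A B \<inter> D = A \<inter> D"
  by (auto simp: swap_def)

lemma swap_indep:
  assumes A: "A \<in> indep" and B: "B \<in> indep" and C: "C \<in> components (A \<union> B)"
  shows "swap C A B \<in> indep"
  unfolding indep_def
proof (intro CollectI conjI ballI)
  show "swap C A B \<subseteq> V" using indepD(1)[OF A] indepD(1)[OF B] by (auto simp: swap_def)
  fix u v assume uv: "u \<in> swap C A B" "v \<in> swap C A B"
  show "\<not> E u v"
  proof
    assume E: "E u v"
    then have "u \<in> C \<longleftrightarrow> v \<in> C"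
      using component_closed[OF C, of u v] component_closed[OF C, of v u] uv E_sym
      by (auto simp: swap_def)
    then show False
      using uv E indepD(3)[OF A, of u v] indepD(3)[OF B, of u v] by (auto simp: swap_def)
  qed
qed

lemma card_swap:
  assumes "A \<in> indep" "B \<in> indep"
  shows "card (swap C A B) + card (A \<inter> C) = card A + card (B \<inter> C)"
proof -
  have fin: "finite A" "finite B" using assms indepD(2) by auto
  have "card (swap C A B) = card (A - C) + card (B \<inter> C)"
    unfolding swap_def using fin by (intro card_Un_disjoint) auto
  moreover have "card A = card (A - C) + card (A \<inter> C)"
    using fin card_Int_Diff[of A C] by simp
  ultimately show ?thesis by simp
qed

text \<open>Swapping inside \<open>C\<close> leaves the union, and so the list of components, unchanged; only the role of
\<open>C\<close> is reversed.\<close>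
lemma excess_swap:
  assumes "C \<in> excess A B"
  shows "excess (swap C A B) (swap C B A) = excess A B - {C}"
    and "excess (swap C B A) (swap C A B) = insert C (excess B A)"
proof -
  have C: "C \<in> components (A \<union> B)" "card (A \<inter> C) = card (B \<inter> C) + 1"
    using assms by (auto simp: excess_def)
  have other: "swap C X Y \<inter> D = X \<inter> D" if "D \<in> components (A \<union> B)" "D \<noteq> C" for X Y D
    using components_disjoint[OF C(1) that(1)] that(2) by (intro swap_Int_disjoint) auto
  show "excess (swap C A B) (swap C B A) = excess A B - {C}"
    unfolding excess_def swap_union
  proof (intro set_eqI)
    fix D
    show "D \<in> {D \<in> components (A \<union> B). card (swap C A B \<inter> D) = card (swap C B A \<inter> D) + 1}
      \<longleftrightarrow> D \<in> {D \<in> components (A \<union> B). card (A \<inter> D) = card (B \<inter> D) + 1} - {C}"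
      using C other[of D]
      by (cases "D = C"; cases "D \<in> components (A \<union> B)") (simp_all add: swap_Int_self)
  qed
  have BA: "B \<union> A = A \<union> B" by blast
  show "excess (swap C B A) (swap C A B) = insert C (excess B A)"
    unfolding excess_def swap_union BA
  proof (intro set_eqI)
    fix D
    show "D \<in> {D \<in> components (A \<union> B). card (swap C B A \<inter> D) = card (swap C A B \<inter> D) + 1}
      \<longleftrightarrow> D \<in> insert C {D \<in> components (A \<union> B). card (B \<inter> D) = card (A \<inter> D) + 1}"
      using C other[of D]
      by (cases "D = C"; cases "D \<in> components (A \<union> B)") (simp_all add: swap_Int_self)
  qed
qed

definition level :: "nat \<Rightarrow> 'a set set" where
  "level k = {S \<in> indep. card S = k}"

lemma finite_level: "finite (level k)"
  using finite_indep by (simp add: level_def)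

text \<open>Consider pairs \<open>(A, B)\<close> of sizes \<open>k + 1\<close> and \<open>k - 1\<close>. If \<open>n\<close> components favour \<open>B\<close>, then \<open>n + 2\<close> favour \<open>A\<close>,
and swapping one of these yields a pair of sizes \<open>k\<close>, \<open>k\<close> in which \<open>n + 1\<close> components favour each
side. Give each of the \<open>n + 2\<close> swaps the weight \<open>1 / (n + 2)\<close>. A pair of sizes \<open>k\<close>, \<open>k\<close> with \<open>m\<close>
components favouring each side is reached by at most \<open>m\<close> swaps, each of weight \<open>1 / (m + 1)\<close>, and
\<open>m / (m + 1) \<le> k / (k + 1)\<close> because \<open>m \<le> k\<close>.\<close>
theorem level_ultra_log_concave:
  assumes k: "k \<ge> 1"
  shows "(real k + 1) * (real (card (level (k + 1))) * real (card (level (k - 1))))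
    \<le> real k * (real (card (level k)))\<^sup>2"
proof -
  define X where "X = level (k + 1) \<times> level (k - 1)"
  define Y where "Y = level k \<times> level k"
  define SX where "SX = (SIGMA p:X. excess (fst p) (snd p))"
  define SY where "SY = (SIGMA p:Y. excess (snd p) (fst p))"
  define h where "h = (\<lambda>(p, C). ((swap C (fst p) (snd p), swap C (snd p) (fst p)), C))"
  define f where "f = (\<lambda>(p, C :: 'a set). 1 / (real (card (excess (fst p) (snd p))) + 1))"
  have finX: "finite X" and finY: "finite Y"
    by (auto simp: X_def Y_def finite_level)
  have Xd: "A \<in> indep" "B \<in> indep" "card A = k + 1" "card B = k - 1" if "(A, B) \<in> X" for A B
    using that by (auto simp: X_def level_def)
  have Yd: "A \<in> indep" "B \<in> indep" "card A = k" "card B = k" if "(A, B) \<in> Y" for A B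
    using that by (auto simp: Y_def level_def)
  have fSX: "finite SX" and fSY: "finite SY"
    using finX finY finite_excess Xd Yd by (auto simp: SX_def SY_def intro!: finite_SigmaI)
  have hSY: "h s \<in> SY" and fh: "f (h s) = 1 / real (card (excess (fst (fst s)) (snd (fst s))))"
    if s: "s \<in> SX" for s
  proof -
    obtain A B C where sABC: "s = ((A, B), C)" by (metis prod.collapse)
    have AB: "(A, B) \<in> X" and C: "C \<in> excess A B" using s by (auto simp: sABC SX_def)
    note d = Xd[OF AB]
    have C': "C \<in> components (A \<union> B)" "card (A \<inter> C) = card (B \<inter> C) + 1"
      using C by (auto simp: excess_def)
    have "card (swap C A B) = k" "card (swap C B A) = k"
      using card_swap[of A B C] card_swap[of B A C] d C' k by auto
    moreover have "swap C A B \<in> indep" "swap C B A \<in> indep"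
      using swap_indep[of A B C] swap_indep[of B A C] d C' by (auto simp: Un_commute)
    ultimately show "h s \<in> SY"
      using excess_swap[OF C] by (auto simp: sABC h_def SY_def Y_def level_def)
    have "card (excess A B) > 0"
      using C finite_excess[OF d(1,2)] by (auto simp: card_gt_0_iff)
    then show "f (h s) = 1 / real (card (excess (fst (fst s)) (snd (fst s))))"
      using excess_swap(1)[OF C] C finite_excess[OF d(1,2)]
      by (simp add: sABC h_def f_def of_nat_diff)
  qed
  \<comment> \<open>The swapped component is recorded in the image, so swapping it back recovers the pair.\<close>
  have inj: "inj_on h SX"
  proof (rule inj_on_inverseI)
    fix s assume "s \<in> SX"
    show "h (h s) = s" by (simp add: h_def swap_swap split: prod.splits)
  qed
  have "real (card X) = (\<Sum>p\<in>X. \<Sum>C\<in>excess (fst p) (snd p). 1 / real (card (excess (fst p) (snd p))))"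
  proof -
    have "card (excess (fst p) (snd p)) > 0" if "p \<in> X" for p
      using that card_excess_balance[of "fst p" "snd p"] Xd[of "fst p" "snd p"] k by auto
    then have "(\<Sum>p\<in>X. \<Sum>C\<in>excess (fst p) (snd p). 1 / real (card (excess (fst p) (snd p))))
        = (\<Sum>p\<in>X. 1)"
      by (intro sum.cong) (simp_all add: card_gt_0_iff)
    then show ?thesis by simp
  qed
  also have "\<dots> = (\<Sum>s\<in>SX. 1 / real (card (excess (fst (fst s)) (snd (fst s)))))"
    unfolding SX_def using finX finite_excess Xd by (subst sum.Sigma) (auto simp: case_prod_unfold)
  also have "\<dots> = (\<Sum>s\<in>SX. f (h s))"
    by (intro sum.cong) (auto simp: fh)
  also have "\<dots> = (\<Sum>t\<in>h ` SX. f t)"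
    using inj by (simp add: sum.reindex)
  also have "\<dots> \<le> (\<Sum>t\<in>SY. f t)"
    using fSY hSY by (intro sum_mono2) (auto simp: f_def)
  also have "\<dots> = (\<Sum>p\<in>Y. \<Sum>C\<in>excess (snd p) (fst p). f (p, C))"
    unfolding SY_def using finY finite_excess Yd by (subst sum.Sigma) (auto simp: case_prod_unfold)
  also have "\<dots> \<le> (\<Sum>p\<in>Y. real k / (real k + 1))"
  proof (rule sum_mono)
    fix p assume p: "p \<in> Y"
    define n where "n = card (excess (fst p) (snd p))"
    note d = Yd[of "fst p" "snd p"]
    have "card (excess (snd p) (fst p)) = n"
      using card_excess_balance[of "fst p" "snd p"] d p by (simp add: n_def)
    moreover have "n \<le> k"
      using card_excess_le[of "fst p" "snd p"] d p by (simp add: n_def)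
    ultimately show "(\<Sum>C\<in>excess (snd p) (fst p). f (p, C)) \<le> real k / (real k + 1)"
      by (simp add: f_def n_def[symmetric] divide_simps algebra_simps)
  qed
  also have "\<dots> = real (card Y) * (real k / (real k + 1))" by simp
  finally show ?thesis
    by (simp add: X_def Y_def card_cartesian_product divide_simps algebra_simps power2_eq_square)
qed

end

section \<open>Log-concave sequences and linear recursions\<close>

text \<open>The quotients \<open>p (k + 1) / p k\<close> decrease where \<open>p\<close> is positive; this is the form without division.\<close>
lemma log_concave_cross:
  fixes p :: "nat \<Rightarrow> real"
  assumes "i \<le> j"
    and "\<And>k. \<lbrakk>i \<le> k; k < j\<rbrakk> \<Longrightarrow> p k * p (k + 2) \<le> (p (k + 1))\<^sup>2"
    and "\<And>k. \<lbrakk>i \<le> k; k \<le> j + 1\<rbrakk> \<Longrightarrow> p k > 0"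
  shows "p (j + 1) * p i \<le> p (i + 1) * p j"
  using assms
proof (induction j rule: dec_induct)
  case base
  then show ?case by simp
next
  case (step j)
  have pos: "p j > 0" "p i > 0" "p (j + 1) > 0"
    using step.prems(2)[of j] step.prems(2)[of i] step.prems(2)[of "j + 1"] step.hyps by auto
  have "p j * (p (j + 2) * p i) \<le> (p (j + 1) * p (j + 1)) * p i"
    using step.prems(1)[of j] step.hyps pos
    by (simp add: power2_eq_square mult.assoc[symmetric] mult_right_mono)
  also have "\<dots> = p (j + 1) * (p (j + 1) * p i)" by simp
  also have "\<dots> \<le> p (j + 1) * (p (i + 1) * p j)"
    using step.IH[OF step.prems(1) step.prems(2)] step.hyps pos by (intro mult_left_mono) auto
  also have "\<dots> = p j * (p (i + 1) * p (j + 1))" by simp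
  finally show ?case using pos by (simp add: mult_le_cancel_left_pos)
qed

text \<open>Zeros are harmless because the support is an interval: if the left-hand side is nonzero, then \<open>q\<close> is
positive on all of \<open>{i..j + 1}\<close>.\<close>
lemma log_concave_cross_nonneg:
  assumes lc: "log_concave q" and nn: "\<And>k. q k \<ge> 0" and "i \<le> j"
  shows "q (j + 1) * q i \<le> q (i + 1) * q j"
proof (cases "q (j + 1) = 0 \<or> q i = 0")
  case True
  then show ?thesis using nn by auto
next
  case False
  then have "{i..j + 1} \<subseteq> {k. q k \<noteq> 0}"
    using lc by (auto simp: log_concave_def)
  then have "q k > 0" if "i \<le> k" "k \<le> j + 1" for k
    using that nn[of k] by (force simp: less_le)
  moreover have "q k * q (k + 2) \<le> (q (k + 1))\<^sup>2" for k
  proof -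
    have "(q (k + 1))\<^sup>2 \<ge> q (k + 1 + 1) * q (k + 1 - 1)"
      using lc unfolding log_concave_def by (metis le_add2)
    then show ?thesis by (simp add: mult.commute)
  qed
  ultimately show ?thesis using \<open>i \<le> j\<close> by (intro log_concave_cross) auto
qed

text \<open>The Binet-Cauchy identity for two pairs of vectors, with the sum of products of minors taken over all
ordered pairs of indices, whence the factor \<open>2\<close>.\<close>
lemma double_sum_minors:
  fixes a b c d :: "'i \<Rightarrow> real"
  shows "(\<Sum>k\<in>K. \<Sum>l\<in>K. (a l * b k - a k * b l) * (c k * d l - c l * d k))
    = 2 * ((\<Sum>k\<in>K. a k * d k) * (\<Sum>k\<in>K. b k * c k) - (\<Sum>k\<in>K. a k * c k) * (\<Sum>k\<in>K. b k * d k))"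
proof -
  have "(\<Sum>k\<in>K. \<Sum>l\<in>K. (a l * b k - a k * b l) * (c k * d l - c l * d k))
    = (\<Sum>k\<in>K. \<Sum>l\<in>K. (b k * c k) * (a l * d l)) + (\<Sum>k\<in>K. \<Sum>l\<in>K. (a k * d k) * (b l * c l))
      - (\<Sum>k\<in>K. \<Sum>l\<in>K. (b k * d k) * (a l * c l)) - (\<Sum>k\<in>K. \<Sum>l\<in>K. (a k * c k) * (b l * d l))"
    unfolding sum.distrib[symmetric] sum_subtractf[symmetric]
    by (intro sum.cong refl) (simp add: algebra_simps)
  also have "\<dots> = (\<Sum>k\<in>K. b k * c k) * (\<Sum>k\<in>K. a k * d k) + (\<Sum>k\<in>K. a k * d k) * (\<Sum>k\<in>K. b k * c k)
      - (\<Sum>k\<in>K. b k * d k) * (\<Sum>k\<in>K. a k * c k) - (\<Sum>k\<in>K. a k * c k) * (\<Sum>k\<in>K. b k * d k)"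
    by (simp only: sum_product)
  finally show ?thesis by (simp only: mult.commute) (simp add: algebra_simps)
qed

lemma recursion_pos:
  fixes p r :: "nat \<Rightarrow> real"
  assumes rec: "\<And>n. real (n + 1) * p (n + 1) = (\<Sum>k\<le>n. p (n - k) * r k)"
    and "p 0 > 0" "r 0 > 0" "\<And>k. r k \<ge> 0"
  shows "p n > 0"
proof (induction n rule: less_induct)
  case (less n)
  show ?case
  proof (cases n)
    case (Suc m)
    have pos: "p (m - k) > 0" for k using less[of "m - k"] Suc by simp
    have "0 < (\<Sum>k\<le>m. p (m - k) * r k)"
      using pos[of 0] pos[THEN less_imp_le] assms
      by (intro sum_pos2[of "{..m}" 0]) (simp_all only: finite_atMost atMost_iff le0 mult_nonneg_nonneg mult_pos_pos diff_zero)
    then have "0 < real (m + 1) * p (m + 1)" by (simp only: rec)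
    then show ?thesis using Suc by (simp add: zero_less_mult_iff)
  qed (use assms in simp)
qed

text \<open>An argument of Hansen. With \<open>p (-1) = 0\<close>, the recursion and the Binet-Cauchy identity give
  \<open>m * (m + 2) * ((p (m + 1))\<^sup>2 - p m * p (m + 2)) = p (m + 1) * (r 0 * p m - p (m + 1)) + D\<close>,
where \<open>D\<close> is the sum over \<open>k < l \<le> m\<close> of the products of minors
  \<open>(p (m - l) * p (m - k - 1) - p (m - k) * p (m - l - 1)) * (r (k + 1) * r l - r (l + 1) * r k)\<close>.
On the right only indices up to \<open>m + 1\<close> of \<open>p\<close> occur. There \<open>p\<close> is log-concave by induction, so its
minors are nonnegative and \<open>p (m + 1) / p m \<le> p 1 / p 0 = r 0\<close>; the minors of \<open>r\<close> are nonnegative by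
hypothesis. At \<open>m = 0\<close> the identity is void, and the assertion is \<open>r 1 \<le> (r 0)\<^sup>2\<close>.\<close>
lemma recursion_log_concave:
  fixes p r :: "nat \<Rightarrow> real"
  assumes rec: "\<And>n. real (n + 1) * p (n + 1) = (\<Sum>k\<le>n. p (n - k) * r k)"
    and p0: "p 0 > 0" and r0: "r 0 > 0" and r_nonneg: "\<And>k. r k \<ge> 0"
    and r_cross: "\<And>k l. k \<le> l \<Longrightarrow> r (l + 1) * r k \<le> r (k + 1) * r l"
    and r1: "r 1 \<le> (r 0)\<^sup>2"
  shows "p m * p (m + 2) \<le> (p (m + 1))\<^sup>2"
proof (induction m rule: less_induct)
  case (less m)
  note pos = recursion_pos[of p r, OF rec p0 r0 r_nonneg]
  have p1: "p 1 = p 0 * r 0" using rec[of 0] by simp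
  show ?case
  proof (cases "m = 0")
    case True
    have "2 * p 2 = p 1 * r 0 + p 0 * r 1" using rec[of 1] by (simp add: numeral_2_eq_2)
    then have "2 * (p 0 * p 2) = (p 0)\<^sup>2 * ((r 0)\<^sup>2 + r 1)"
      by (simp add: p1[unfolded One_nat_def] power2_eq_square algebra_simps)
    also have "\<dots> \<le> (p 0)\<^sup>2 * (2 * (r 0)\<^sup>2)"
      using r1 by (intro mult_left_mono) auto
    finally show ?thesis using True p1[unfolded One_nat_def] by (simp add: numeral_2_eq_2[symmetric] power2_eq_square algebra_simps)
  next
    case False
    have cross: "p (j + 1) * p i \<le> p (i + 1) * p j" if "i \<le> j" "j \<le> m" for i j
      using that less pos by (intro log_concave_cross) auto
    define a where "a k = p (m - k)" for k
    \<comment> \<open>The value \<open>0\<close> at \<open>k = m\<close> plays the part of \<open>p (-1)\<close>.\<close>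
    define b where "b k = (if k < m then p (m - k - 1) else 0)" for k
    define c where "c k = r (k + 1)" for k
    have ad: "(\<Sum>k\<le>m. a k * r k) = real (m + 1) * p (m + 1)"
      by (simp only: a_def rec)
    have "real (m + 2) * p (m + 2) = (\<Sum>k\<le>Suc m. p (m + 1 - k) * r k)"
      using rec[of "m + 1"] by simp
    also have "\<dots> = p (m + 1) * r 0 + (\<Sum>k\<le>m. a k * c k)"
      by (subst sum.atMost_Suc_shift) (simp add: a_def c_def)
    finally have ac: "(\<Sum>k\<le>m. a k * c k) = real (m + 2) * p (m + 2) - r 0 * p (m + 1)"
      by simp
    obtain m' where m': "m = Suc m'" using False by (cases m) auto
    have "real (m + 1) * p (m + 1) = p m * r 0 + (\<Sum>k\<le>m'. p (m' - k) * r (k + 1))"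
      unfolding rec m' by (subst sum.atMost_Suc_shift) simp
    moreover have "(\<Sum>k\<le>m. b k * c k) = (\<Sum>k\<le>m'. p (m' - k) * r (k + 1))"
      unfolding m' by (subst sum.atMost_Suc) (auto simp: b_def c_def m' intro!: sum.cong)
    ultimately have bc: "(\<Sum>k\<le>m. b k * c k) = real (m + 1) * p (m + 1) - r 0 * p m"
      by simp
    have "(\<Sum>k\<le>m. b k * r k) = (\<Sum>k\<le>m'. p (m' - k) * r k)"
      unfolding m' by (subst sum.atMost_Suc) (auto simp: b_def m' intro!: sum.cong)
    then have bd: "(\<Sum>k\<le>m. b k * r k) = real m * p m"
      using rec[of m'] by (simp add: m')
    have minor: "0 \<le> (a l * b k - a k * b l) * (c k * r l - c l * r k)" if "k \<le> l" "l \<le> m" for k l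
    proof -
      have "a k * b l \<le> a l * b k"
      proof (cases "k < l \<and> l < m")
        case True
        then have "p (m - k - 1 + 1) * p (m - l - 1) \<le> p (m - l - 1 + 1) * p (m - k - 1)"
          by (intro cross) auto
        moreover have "m - k - 1 + 1 = m - k" "m - l - 1 + 1 = m - l" using True by auto
        ultimately show ?thesis using True unfolding a_def b_def by simp
      next
        case False
        then show ?thesis using that pos[THEN less_imp_le] by (auto simp: a_def b_def)
      qed
      moreover have "c l * r k \<le> c k * r l" using r_cross[OF that(1)] by (simp add: c_def)
      ultimately show ?thesis by simp
    qed
    have "0 \<le> (\<Sum>k\<le>m. \<Sum>l\<le>m. (a l * b k - a k * b l) * (c k * r l - c l * r k))"
    proof (intro sum_nonneg)
      fix k l assume "k \<in> {..m}" "l \<in> {..m}"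
      then show "0 \<le> (a l * b k - a k * b l) * (c k * r l - c l * r k)"
        using minor[of k l] minor[of l k] by (cases "k \<le> l") (auto simp: algebra_simps)
    qed
    then have "(real (m + 2) * p (m + 2) - r 0 * p (m + 1)) * (real m * p m)
        \<le> (real (m + 1) * p (m + 1)) * (real (m + 1) * p (m + 1) - r 0 * p m)"
      unfolding double_sum_minors ad ac bc bd by simp
    then have "real m * real (m + 2) * (p m * p (m + 2)) + p (m + 1) * (r 0 * p m - p (m + 1))
        \<le> real m * real (m + 2) * (p (m + 1))\<^sup>2"
      by (simp add: algebra_simps power2_eq_square)
    moreover have "p (m + 1) \<le> r 0 * p m"
      using cross[of 0 m] p0 p1 by (simp add: mult.commute mult.left_commute)
    then have "0 \<le> p (m + 1) * (r 0 * p m - p (m + 1))"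
      using pos[of "m + 1"] by simp
    ultimately have "real m * real (m + 2) * (p m * p (m + 2)) \<le> real m * real (m + 2) * (p (m + 1))\<^sup>2"
      by linarith
    then show ?thesis using False by (simp add: mult_le_cancel_left_pos)
  qed
qed

section \<open>Log-concavity of compound Poisson distributions\<close>

lemma conv_power_eq_fps: "conv_power q n x = fps_nth (Abs_fps q ^ n) x"
proof (induction n arbitrary: x)
  case (Suc n)
  have "conv_power q (Suc n) x = (\<Sum>k=0..x. fps_nth (Abs_fps q ^ n) k * fps_nth (Abs_fps q) (x - k))"
    by (simp add: convolve_def Suc atLeast0AtMost)
  also have "\<dots> = fps_nth (Abs_fps q ^ n * Abs_fps q) x"
    by (simp only: fps_mult_nth)
  finally show ?case by (simp add: mult.commute)
qed simp

text \<open>Compare coefficients in \<open>(F ^ (m + 1))' = (m + 1) * F' * F ^ m\<close> for the generating function \<open>F\<close> of \<open>q\<close>.\<close>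
lemma conv_power_recursion:
  "real (n + 1) * conv_power q (m + 1) (n + 1)
    = real (m + 1) * (\<Sum>j\<le>n. conv_power q m (n - j) * (real (j + 1) * q (j + 1)))"
proof -
  let ?F = "Abs_fps q"
  have "real (n + 1) * conv_power q (m + 1) (n + 1) = fps_nth (fps_deriv (?F ^ (m + 1))) n"
    by (simp only: conv_power_eq_fps fps_deriv_nth)
  also have "\<dots> = fps_nth (fps_const (real (m + 1)) * (fps_deriv ?F * ?F ^ m)) n"
    by (subst fps_deriv_power) (simp add: mult.assoc)
  also have "\<dots> = real (m + 1) * (\<Sum>j=0..n. fps_nth (fps_deriv ?F) j * fps_nth (?F ^ m) (n - j))"
    by (subst fps_mult_left_const_nth, subst fps_mult_nth) (rule refl)
  also have "\<dots> = real (m + 1) * (\<Sum>j\<le>n. conv_power q m (n - j) * (real (j + 1) * q (j + 1)))"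
    by (simp add: conv_power_eq_fps atLeast0AtMost mult.commute)
  finally show ?thesis .
qed

lemma conv_power_eq_0:
  assumes "q 0 = 0" "x < n"
  shows "conv_power q n x = 0"
  using assms(2)
proof (induction n arbitrary: x)
  case (Suc n)
  have "conv_power q n k * q (x - k) = 0" if "k \<le> x" for k
    using that Suc assms(1) by (cases "k < n") auto
  then show ?case by (auto simp: convolve_def intro!: sum.neutral)
qed simp

text \<open>As \<open>q\<close> has no mass at \<open>0\<close>, a sum of more than \<open>x\<close> variables exceeds \<open>x\<close>, and the series is finite.\<close>
lemma compound_eq_sum:
  assumes "q 0 = 0" "x \<le> n"
  shows "compound q p x = (\<Sum>y\<le>n. p y * conv_power q y x)"
  unfolding compound_def
  using assms by (intro suminf_finite) (auto simp: conv_power_eq_0)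

lemma poisson_mass_Suc: "real (y + 1) * poisson_mass l (y + 1) = l * poisson_mass l y"
  by (simp add: poisson_mass_def divide_simps)

text \<open>The Panjer recursion: the recursion for convolution powers carries a factor \<open>y + 1\<close>, which the Poisson
weight absorbs through \<open>(y + 1) * poisson_mass l (y + 1) = l * poisson_mass l y\<close>.\<close>
lemma compound_poisson_recursion:
  fixes q :: "nat \<Rightarrow> real" and l :: real
  assumes q0: "q 0 = 0"
  defines "R \<equiv> compound q (poisson_mass l)"
  shows "real (n + 1) * R (n + 1) = (\<Sum>k\<le>n. R (n - k) * (l * (real (k + 1) * q (k + 1))))"
proof -
  have "real (n + 1) * R (n + 1)
      = (\<Sum>y\<le>Suc n. poisson_mass l y * (real (n + 1) * conv_power q y (n + 1)))"
    by (simp add: R_def compound_eq_sum[where q = q and n = "Suc n", OF q0] sum_distrib_left algebra_simps)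
  also have "\<dots> = (\<Sum>y\<le>n. poisson_mass l (y + 1) * (real (n + 1) * conv_power q (y + 1) (n + 1)))"
    by (subst sum.atMost_Suc_shift) simp
  also have "\<dots> = (\<Sum>y\<le>n. l * poisson_mass l y
      * (\<Sum>k\<le>n. conv_power q y (n - k) * (real (k + 1) * q (k + 1))))"
    unfolding conv_power_recursion poisson_mass_Suc[symmetric] by (simp add: algebra_simps)
  also have "\<dots> = (\<Sum>k\<le>n. (\<Sum>y\<le>n. poisson_mass l y * conv_power q y (n - k))
      * (l * (real (k + 1) * q (k + 1))))"
    unfolding sum_distrib_left sum_distrib_right by (subst sum.swap) (simp add: algebra_simps)
  also have "\<dots> = (\<Sum>k\<le>n. R (n - k) * (l * (real (k + 1) * q (k + 1))))"
    by (simp add: R_def compound_eq_sum[where q = q and n = n, OF q0])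
  finally show ?thesis .
qed

text \<open>The coefficients \<open>r k = l * (k + 1) * q (k + 1)\<close> of the recursion are a product of two log-concave
sequences. The hypothesis on the rate says \<open>r 1 \<le> (r 0)\<^sup>2\<close>.\<close>
lemma
  assumes q0: "q 0 = 0" and lc: "log_concave q" and nn: "\<And>k. q k \<ge> 0"
    and q1: "q 1 > 0" and l: "l > 0" and rate: "2 * q 2 \<le> l * (q 1)\<^sup>2"
  shows compound_poisson_pos: "compound q (poisson_mass l) n > 0"
    and compound_poisson_log_concave:
      "compound q (poisson_mass l) n * compound q (poisson_mass l) (n + 2)
        \<le> (compound q (poisson_mass l) (n + 1))\<^sup>2"
proof -
  define R where "R = compound q (poisson_mass l)"
  define r where "r k = l * (real (k + 1) * q (k + 1))" for k
  have rec: "real (n + 1) * R (n + 1) = (\<Sum>k\<le>n. R (n - k) * r k)" for n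
    unfolding R_def r_def by (rule compound_poisson_recursion[where q = q and l = l and n = n, OF q0])
  have R0: "R 0 > 0"
    by (simp add: R_def compound_eq_sum[where q = q and n = 0, OF q0] poisson_mass_def)
  have r0: "r 0 > 0" and rn: "\<And>k. r k \<ge> 0"
    using q1 l nn by (auto simp: r_def)
  have cross: "r (j + 1) * r i \<le> r (i + 1) * r j" if "i \<le> j" for i j
  proof -
    have qq: "q (j + 2) * q (i + 1) \<le> q (i + 2) * q (j + 1)"
      using log_concave_cross_nonneg[OF lc nn, of "i + 1" "j + 1"] that by simp
    have ii: "real (j + 2) * real (i + 1) \<le> real (i + 2) * real (j + 1)"
      using that by (simp add: algebra_simps)
    have "(real (j + 2) * real (i + 1)) * (q (j + 2) * q (i + 1))
        \<le> (real (i + 2) * real (j + 1)) * (q (i + 2) * q (j + 1))"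
      by (rule mult_mono[OF ii qq]) (simp_all add: nn)
    from mult_left_mono[OF this, of "l\<^sup>2"] show ?thesis
      by (simp add: r_def power2_eq_square algebra_simps)
  qed
  have "l * (2 * q 2) \<le> l * (l * (q 1)\<^sup>2)"
    using rate l by (intro mult_left_mono) auto
  then have r1: "r 1 \<le> (r 0)\<^sup>2"
    by (simp add: r_def power2_eq_square algebra_simps numeral_2_eq_2)
  show "compound q (poisson_mass l) n > 0"
    using recursion_pos[of R r, OF rec R0 r0 rn] by (simp add: R_def)
  show "compound q (poisson_mass l) n * compound q (poisson_mass l) (n + 2)
      \<le> (compound q (poisson_mass l) (n + 1))\<^sup>2"
    using recursion_log_concave[of R r, OF rec R0 r0 rn cross r1] by (simp add: R_def)
qed

section \<open>Convex order from log-concave likelihood ratios\<close>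

text \<open>The line through \<open>j\<close> with the forward difference at \<open>j\<close> as slope supports \<open>\<psi>\<close>, on both sides of \<open>j\<close>.\<close>
lemma discrete_convex_tangent:
  fixes \<psi> :: "nat \<Rightarrow> real"
  assumes conv: "\<And>k. 2 * \<psi> (k + 1) \<le> \<psi> k + \<psi> (k + 2)"
  shows "\<psi> j + (real x - real j) * (\<psi> (j + 1) - \<psi> j) \<le> \<psi> x"
proof -
  define d where "d k = \<psi> (k + 1) - \<psi> k" for k
  have "d k \<le> d (Suc k)" for k
    using conv[of k] by (simp add: d_def)
  then have mono: "d i \<le> d k" if "i \<le> k" for i k using that by (rule lift_Suc_mono_le)
  have "\<psi> j + (real x - real j) * d j \<le> \<psi> x"
  proof (cases "j \<le> x")
    case True
    then show ?thesis
    proof (induction x rule: dec_induct)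
      case (step x)
      have "(real (Suc x) - real j) * d j = (real x - real j) * d j + d j"
        by (simp add: algebra_simps)
      moreover have "\<psi> (Suc x) = \<psi> x + d x" by (simp add: d_def)
      ultimately show ?case using mono[OF step.hyps(1)] step.IH by linarith
    qed simp
  next
    case False
    then have "x \<le> j" by simp
    then show ?thesis
    proof (induction x rule: inc_induct)
      case (step x)
      have "(real x - real j) * d j = (real (Suc x) - real j) * d j - d j"
        by (simp add: algebra_simps)
      moreover have "\<psi> (Suc x) = \<psi> x + d x" by (simp add: d_def)
      moreover have "d x \<le> d j" using step.hyps by (intro mono) simp
      ultimately show ?case using step.IH by linarith
    qed simp
  qed
  then show ?thesis by (simp add: d_def)
qed

text \<open>Average the supporting line at \<open>j\<close> over \<open>i\<close> and \<open>k\<close> with the weights that cancel its slope.\<close>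
lemma discrete_convex_three_points:
  fixes \<psi> :: "nat \<Rightarrow> real"
  assumes conv: "\<And>k. 2 * \<psi> (k + 1) \<le> \<psi> k + \<psi> (k + 2)" and "i \<le> j" "j \<le> k"
  shows "(real k - real i) * \<psi> j \<le> (real k - real j) * \<psi> i + (real j - real i) * \<psi> k"
proof -
  note t = discrete_convex_tangent[of \<psi>, OF conv, of j]
  have "(real k - real j) * (\<psi> j + (real i - real j) * (\<psi> (j + 1) - \<psi> j)) \<le> (real k - real j) * \<psi> i"
    by (rule mult_left_mono[OF t]) (simp add: assms)
  moreover have "(real j - real i) * (\<psi> j + (real k - real j) * (\<psi> (j + 1) - \<psi> j)) \<le> (real j - real i) * \<psi> k"
    by (rule mult_left_mono[OF t]) (simp add: assms)
  ultimately show ?thesis by (simp add: algebra_simps)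
qed

text \<open>If \<open>t\<close> were below \<open>c\<close> at \<open>k\<close>, it would have to descend somewhere between \<open>a\<close> and \<open>k\<close>; once it descends,
log-concavity keeps it from rising again, and it is still below \<open>c\<close> at \<open>b\<close>.\<close>
lemma log_concave_upper_level_interval:
  assumes lc: "log_concave t" and nn: "\<And>k. t k \<ge> 0"
    and ab: "a \<le> k" "k \<le> b" and t: "c > 0" "t a \<ge> c" "t b \<ge> c"
  shows "t k \<ge> c"
proof (rule ccontr)
  assume less: "\<not> t k \<ge> c"
  have "{a..b} \<subseteq> {j. t j \<noteq> 0}"
    using lc t by (auto simp: log_concave_def)
  then have pos: "t j > 0" if "a \<le> j" "j \<le> b" for j
    using that nn[of j] by (force simp: less_le)
  have "\<exists>j\<ge>a. j < k \<and> t (j + 1) < t j"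
  proof (rule ccontr)
    assume "\<not> ?thesis"
    then have up: "t j \<le> t (j + 1)" if "a \<le> j" "j < k" for j using that by force
    have "t a \<le> t k"
      using ab(1) up by (induction k rule: dec_induct) force+
    then show False using less t by simp
  qed
  then obtain j where j: "a \<le> j" "j < k" "t (j + 1) < t j" by blast
  have down: "t (i + 1) \<le> t i" if "k \<le> i" "i < b" for i
  proof -
    have "t (i + 1) * t j \<le> t (j + 1) * t i"
      using that j by (intro log_concave_cross_nonneg[OF lc nn]) auto
    also have "\<dots> \<le> t j * t i"
      using j nn by (intro mult_right_mono) auto
    finally show ?thesis using pos[of j] j ab by (simp add: mult.commute)
  qed
  have "t b \<le> t k"
    using ab(2) down by (induction b rule: dec_induct) force+
  then show False using less t by simp
qed

text \<open>Let \<open>{a..b}\<close> be the interval on which \<open>p \<ge> \<pi>\<close>, and subtract from \<open>\<phi>\<close> its chord over this interval. By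
convexity the difference \<open>\<psi>\<close> is nonpositive inside and nonnegative outside, so \<open>(p - \<pi>) * \<psi> \<le> 0\<close>
everywhere. The chord is affine and has the same mean under \<open>p\<close> and \<open>\<pi>\<close>, since their total masses and
their means agree.\<close>
lemma log_concave_ratio_convex_order:
  fixes p \<pi> \<phi> :: "nat \<Rightarrow> real"
  assumes p: "\<And>k. p k \<ge> 0" "finite {k. p k \<noteq> 0}" and \<pi>: "\<And>k. \<pi> k > 0"
    and lc: "log_concave (\<lambda>k. p k / \<pi> k)"
    and sums: "p sums 1" "\<pi> sums 1" "(\<lambda>k. p k * real k) sums l" "(\<lambda>k. \<pi> k * real k) sums l"
    and conv: "\<And>k. 2 * \<phi> (k + 1) \<le> \<phi> k + \<phi> (k + 2)"
    and summable: "summable (\<lambda>k. \<pi> k * \<phi> k)"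
  shows "(\<Sum>k. p k * \<phi> k) \<le> (\<Sum>k. \<pi> k * \<phi> k)"
proof -
  define S where "S = {k. \<pi> k \<le> p k}"
  have "S \<subseteq> {k. p k \<noteq> 0}" using \<pi> by (auto simp: S_def not_le[symmetric])
  then have finS: "finite S" using p(2) by (rule finite_subset)
  have "S \<noteq> {}"
  proof
    assume "S = {}"
    then have "\<pi> k - p k > 0" for k by (auto simp: S_def not_le)
    moreover have "(\<lambda>k. \<pi> k - p k) sums (1 - 1)" using sums by (intro sums_diff)
    ultimately show False
      using suminf_pos[of "\<lambda>k. \<pi> k - p k"] sums_summable sums_unique by force
  qed
  define a where "a = Min S"
  define b where "b = Max S"
  have ab: "a \<in> S" "b \<in> S" "a \<le> b" and bounds: "\<And>k. k \<in> S \<Longrightarrow> a \<le> k \<and> k \<le> b"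
    using finS \<open>S \<noteq> {}\<close> by (auto simp: a_def b_def)
  have S_iff: "k \<in> S \<longleftrightarrow> p k / \<pi> k \<ge> 1" for k using \<pi>[of k] by (simp add: S_def)
  have S: "k \<in> S \<longleftrightarrow> a \<le> k \<and> k \<le> b" for k
  proof
    assume "a \<le> k \<and> k \<le> b"
    then show "k \<in> S"
      using log_concave_upper_level_interval[OF lc, of a k b 1] ab(1,2) p(1) \<pi>[THEN less_imp_le]
      unfolding S_iff by simp
  qed (rule bounds)
  \<comment> \<open>A chord needs two points. If \<open>a = b\<close>, the one over \<open>{a, a + 1}\<close> does as well, since \<open>\<psi>\<close> vanishes at both ends.\<close>
  define b' where "b' = max b (a + 1)"
  have ab': "a < b'" by (simp add: b'_def)
  define \<beta> where "\<beta> = (\<phi> b' - \<phi> a) / (real b' - real a)"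
  define \<alpha> where "\<alpha> = \<phi> a - \<beta> * real a"
  define \<psi> where "\<psi> k = \<phi> k - \<alpha> - \<beta> * real k" for k
  have \<psi>a: "\<psi> a = 0" by (simp add: \<psi>_def \<alpha>_def)
  have \<psi>b: "\<psi> b' = 0" using ab' by (simp add: \<psi>_def \<alpha>_def \<beta>_def field_simps)
  have \<psi>_conv: "2 * \<psi> (k + 1) \<le> \<psi> k + \<psi> (k + 2)" for k
    using conv[of k] by (simp add: \<psi>_def algebra_simps)
  note three = discrete_convex_three_points[of \<psi>, OF \<psi>_conv]
  have inside: "\<psi> k \<le> 0" if "a \<le> k" "k \<le> b'" for k
    using three[of a k b'] that ab' by (simp add: \<psi>a \<psi>b mult_le_0_iff)
  have outside: "\<psi> k \<ge> 0" if "k \<le> a \<or> b' \<le> k" for k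
    using three[of a b' k] three[of k a b'] that ab' by (auto simp: \<psi>a \<psi>b zero_le_mult_iff)
  have "(p k - \<pi> k) * \<psi> k \<le> 0" for k
  proof (cases "k \<in> S")
    case True
    then have "p k - \<pi> k \<ge> 0" "\<psi> k \<le> 0"
      using S inside[of k] by (auto simp: S_def b'_def)
    then show ?thesis by (rule mult_nonneg_nonpos)
  next
    case False
    then have "k < a \<or> b < k" using S[of k] by linarith
    then have "k \<le> a \<or> b' \<le> k" using ab(3) unfolding b'_def by linarith
    then have "\<psi> k \<ge> 0" by (rule outside)
    moreover have "p k - \<pi> k \<le> 0" using False by (simp add: S_def)
    ultimately show ?thesis by (simp add: mult_nonpos_nonneg)
  qed
  then have le: "\<forall>k. (p k - \<pi> k) * \<psi> k \<le> 0" by blast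
  have "(\<lambda>k. (p k - \<pi> k) * \<psi> k) sums ((\<Sum>k. p k * \<phi> k) - (\<Sum>k. \<pi> k * \<phi> k))"
  proof -
    have "summable (\<lambda>k. p k * \<phi> k)"
      by (rule summable_finite[OF p(2)]) auto
    then have "(\<lambda>k. (p k * \<phi> k - \<pi> k * \<phi> k) - \<alpha> * (p k - \<pi> k) - \<beta> * (p k * real k - \<pi> k * real k))
      sums (((\<Sum>k. p k * \<phi> k) - (\<Sum>k. \<pi> k * \<phi> k)) - \<alpha> * (1 - 1) - \<beta> * (l - l))"
      using summable sums by (intro sums_diff sums_mult summable_sums)
    moreover have "(p k * \<phi> k - \<pi> k * \<phi> k) - \<alpha> * (p k - \<pi> k) - \<beta> * (p k * real k - \<pi> k * real k)
        = (p k - \<pi> k) * \<psi> k" for k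
      unfolding \<psi>_def by algebra
    ultimately show ?thesis by (simp only: diff_self mult_zero_right diff_zero)
  qed
  then have "(\<Sum>k. p k * \<phi> k) - (\<Sum>k. \<pi> k * \<phi> k) \<le> 0"
    by (rule sums_le[rotated, OF _ sums_zero]) (use le in blast)
  then show ?thesis by simp
qed

section \<open>Maximum entropy of compound Poisson distributions\<close>

primrec iid_sum :: "nat pmf \<Rightarrow> nat \<Rightarrow> nat pmf" where
  "iid_sum Q 0 = return_pmf 0"
| "iid_sum Q (Suc n) = bind_pmf (iid_sum Q n) (\<lambda>s. map_pmf (\<lambda>a. s + a) Q)"

lemma pmf_map_add: "pmf (map_pmf (\<lambda>a. s + a) Q) x = (if s \<le> x then pmf Q (x - s) else 0)" for s x :: nat
proof (cases "s \<le> x")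
  case True
  then show ?thesis
    using pmf_map_inj'[of "\<lambda>a. s + a" Q "x - s"] by (simp add: inj_on_def)
next
  case False
  then have "x \<notin> set_pmf (map_pmf (\<lambda>a. s + a) Q)" by auto
  then have "pmf (map_pmf (\<lambda>a. s + a) Q) x = 0" by (simp only: pmf_eq_0_set_pmf not_False_eq_True)
  then show ?thesis using False by simp
qed

lemma pmf_iid_sum: "pmf (iid_sum Q n) x = conv_power (pmf Q) n x"
proof (induction n arbitrary: x)
  case (Suc n)
  have "pmf (iid_sum Q (Suc n)) x
      = (\<integral>s. (if s \<le> x then pmf Q (x - s) else 0) \<partial>measure_pmf (iid_sum Q n))"
    by (simp add: pmf_bind pmf_map_add)
  also have "\<dots> = (\<Sum>s\<le>x. (if s \<le> x then pmf Q (x - s) else 0) * pmf (iid_sum Q n) s)"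
    by (intro integral_measure_pmf_real) (auto split: if_splits)
  also have "\<dots> = conv_power (pmf Q) (Suc n) x"
    by (simp add: convolve_def Suc mult.commute)
  finally show ?case .
qed (simp add: pmf_return indicator_def)

lemma pmf_bind_iid_sum:
  assumes "pmf Q 0 = 0"
  shows "pmf (bind_pmf p (iid_sum Q)) x = compound (pmf Q) (pmf p) x"
proof -
  have "pmf (bind_pmf p (iid_sum Q)) x = (\<Sum>y\<le>x. conv_power (pmf Q) y x * pmf p y)"
    unfolding pmf_bind pmf_iid_sum
    using conv_power_eq_0[of "pmf Q", OF assms]
    by (intro integral_measure_pmf_real) (auto simp: not_le[symmetric])
  then show ?thesis
    using compound_eq_sum[where q = "pmf Q" and n = x, OF assms] by (simp add: mult.commute)
qed

lemma suminf_ennreal_pmf: "(\<Sum>x. ennreal (pmf p x)) = 1" for p :: "nat pmf"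
proof -
  have "(\<Sum>x. ennreal (pmf p x)) = (\<integral>\<^sup>+x. ennreal (pmf p x) \<partial>count_space UNIV)"
    by (rule nn_integral_count_space_nat[symmetric])
  also have "\<dots> = emeasure (measure_pmf p) UNIV" by (rule nn_integral_pmf)
  also have "\<dots> = 1" by (rule measure_pmf.emeasure_space_1[of p, unfolded space_measure_pmf])
  finally show ?thesis .
qed

lemma pmf_sums: "pmf p sums 1" for p :: "nat pmf"
proof -
  have s: "summable (pmf p)" by (rule summable_suminf_not_top) (simp_all add: suminf_ennreal_pmf)
  have "ennreal (\<Sum>x. pmf p x) = 1"
    using suminf_ennreal2[of "pmf p", OF _ s] by (simp add: suminf_ennreal_pmf)
  then show ?thesis using s by (simp add: sums_iff)
qed

lemma nn_integral_nat_pmf: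
  "(\<integral>\<^sup>+x. f x \<partial>measure_pmf p) = (\<Sum>x. ennreal (pmf p x) * f x)" for p :: "nat pmf"
  by (simp add: nn_integral_measure_pmf nn_integral_count_space_nat)

lemma mass_entropy_pmf:
  "mass_entropy (pmf p) = (\<integral>\<^sup>+x. ennreal (- ln (pmf p x)) \<partial>measure_pmf p)"
  unfolding nn_integral_nat_pmf mass_entropy_def
  by (intro suminf_cong) (simp add: ennreal_mult'[symmetric])

text \<open>Pointwise \<open>ln (r / p) \<le> r / p - 1\<close>. Both mass functions sum to \<open>1\<close>, so adding \<open>p\<close> on the left and \<open>r\<close> on
the right turns this into a comparison of nonnegative terms, which stays valid if a series
diverges.\<close>
lemma gibbs_inequality:
  fixes p r :: "nat pmf"
  assumes r: "\<And>x. pmf r x > 0"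
  shows "mass_entropy (pmf p) \<le> (\<integral>\<^sup>+x. ennreal (- ln (pmf r x)) \<partial>measure_pmf p)"
proof -
  let ?A = "\<lambda>x. ennreal (- (pmf p x * ln (pmf p x)))"
  let ?B = "\<lambda>x. ennreal (pmf p x) * ennreal (- ln (pmf r x))"
  have "ennreal (pmf p x) + ?A x \<le> ennreal (pmf r x) + ?B x" for x
  proof (cases "pmf p x = 0")
    case False
    then have px: "pmf p x > 0" using pmf_nonneg[of p x] by linarith
    have "ln (pmf r x) - ln (pmf p x) = ln (pmf r x / pmf p x)"
      using px r[of x] by (simp add: ln_div)
    also have "\<dots> \<le> pmf r x / pmf p x - 1"
      using px r[of x] by (intro ln_le_minus_one) simp
    finally have "pmf p x * (ln (pmf r x) - ln (pmf p x)) \<le> pmf p x * (pmf r x / pmf p x - 1)"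
      using px by (intro mult_left_mono) auto
    also have "\<dots> = pmf r x - pmf p x" using px by (simp add: field_simps)
    finally have "pmf p x + - (pmf p x * ln (pmf p x)) \<le> pmf r x + pmf p x * - ln (pmf r x)"
      by (simp add: algebra_simps)
    moreover have "ln (pmf p x) \<le> 0" "ln (pmf r x) \<le> 0"
      using px r[of x] by (simp_all add: pmf_le_1)
    ultimately show ?thesis
      using px r[of x]
      by (simp add: ennreal_mult'[symmetric] ennreal_plus[symmetric] mult_nonneg_nonpos ennreal_leI
          del: ennreal_plus)
  qed simp
  then have "(\<Sum>x. ennreal (pmf p x) + ?A x) \<le> (\<Sum>x. ennreal (pmf r x) + ?B x)"
    by (intro suminf_le) auto
  then have "1 + mass_entropy (pmf p) \<le> 1 + (\<integral>\<^sup>+x. ennreal (- ln (pmf r x)) \<partial>measure_pmf p)"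
    unfolding nn_integral_nat_pmf mass_entropy_def
    by (simp add: suminf_add[symmetric] suminf_ennreal_pmf)
  then show ?thesis by (simp add: ennreal_add_left_cancel_le)
qed

text \<open>Realise the sums of \<open>n\<close>, \<open>n + 1\<close> and \<open>n + 2\<close> variables from one partial sum \<open>s\<close> and two further
variables \<open>a\<close>, \<open>b\<close>, using either of them for the sum of \<open>n + 1\<close>; then integrate the pointwise
inequality.\<close>
lemma nn_integral_iid_sum_convex:
  fixes g :: "nat \<Rightarrow> ennreal"
  assumes g: "\<And>s a b. g (s + a) + g (s + b) \<le> g s + g (s + a + b)"
  shows "(\<integral>\<^sup>+x. g x \<partial>iid_sum Q (n + 1)) + (\<integral>\<^sup>+x. g x \<partial>iid_sum Q (n + 1))
    \<le> (\<integral>\<^sup>+x. g x \<partial>iid_sum Q n) + (\<integral>\<^sup>+x. g x \<partial>iid_sum Q (n + 2))"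
proof -
  have unit: "emeasure (measure_pmf Q) UNIV = 1"
    using measure_pmf.emeasure_space_1[of Q] by simp
  have "(\<integral>\<^sup>+x. g x \<partial>iid_sum Q (n + 1)) + (\<integral>\<^sup>+x. g x \<partial>iid_sum Q (n + 1))
    = (\<integral>\<^sup>+s. (\<integral>\<^sup>+a. (\<integral>\<^sup>+b. g (s + a) + g (s + b) \<partial>Q) \<partial>Q) \<partial>iid_sum Q n)"
    by (simp add: nn_integral_add unit)
  also have "\<dots> \<le> (\<integral>\<^sup>+s. (\<integral>\<^sup>+a. (\<integral>\<^sup>+b. g s + g (s + a + b) \<partial>Q) \<partial>Q) \<partial>iid_sum Q n)"
    by (intro nn_integral_mono g)
  also have "\<dots> = (\<integral>\<^sup>+x. g x \<partial>iid_sum Q n) + (\<integral>\<^sup>+x. g x \<partial>iid_sum Q (n + 2))"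
    by (simp add: nn_integral_add unit)
  finally show ?thesis .
qed

text \<open>Forward differences of a convex sequence increase, so a step of length \<open>a\<close> from \<open>s + b\<close> raises \<open>G\<close> at
least as much as one from \<open>s\<close>.\<close>
lemma convex_four_points:
  fixes G :: "nat \<Rightarrow> real"
  assumes conv: "\<And>k. 2 * G (k + 1) \<le> G k + G (k + 2)"
  shows "G (s + a) + G (s + b) \<le> G s + G (s + a + b)"
proof (induction a)
  case (Suc a)
  define d where "d k = G (Suc k) - G k" for k
  have "d k \<le> d (Suc k)" for k using conv[of k] by (simp add: d_def)
  then have "d (s + a) \<le> d (s + a + b)" by (rule lift_Suc_mono_le) simp
  then show ?case using Suc by (simp add: d_def)
qed simp

text \<open>If the compound Poisson entropy is infinite there is nothing to show; otherwise
\<open>\<Phi>\<close> is finite everywhere, because the Poisson law charges every number of summands, and the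
comparison can be made between convergent real series.\<close>
theorem compound_entropy_le:
  fixes p Q :: "nat pmf" and l :: real
  assumes Q0: "pmf Q 0 = 0" and Qlc: "log_concave (pmf Q)" and Q1: "pmf Q 1 > 0"
    and rate: "2 * pmf Q 2 \<le> l * (pmf Q 1)\<^sup>2" and l: "l > 0"
    and fin: "finite (set_pmf p)" and mean: "measure_pmf.expectation p real = l"
    and ulc: "log_concave (\<lambda>k. pmf p k / poisson_mass l k)"
  shows "mass_entropy (pmf (bind_pmf p (iid_sum Q))) \<le> mass_entropy (compound (pmf Q) (poisson_mass l))"
proof (cases "mass_entropy (compound (pmf Q) (poisson_mass l)) = \<infinity>")
  case False
  define R where "R = bind_pmf (poisson_pmf l) (iid_sum Q)"
  have pois: "pmf (poisson_pmf l) = poisson_mass l"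
    using l by (auto simp: poisson_mass_def)
  have R: "pmf R = compound (pmf Q) (poisson_mass l)"
    unfolding R_def by (rule ext) (simp add: pmf_bind_iid_sum Q0 pois)
  have Rpos: "pmf R x > 0" for x
    unfolding R by (rule compound_poisson_pos[OF Q0 Qlc pmf_nonneg Q1 l rate])
  have Rlc: "pmf R x * pmf R (x + 2) \<le> (pmf R (x + 1))\<^sup>2" for x
    unfolding R by (rule compound_poisson_log_concave[OF Q0 Qlc pmf_nonneg Q1 l rate])
  define G where "G x = - ln (pmf R x)" for x
  have Gnn: "G x \<ge> 0" for x using Rpos[of x] by (simp add: G_def pmf_le_1)
  have "2 * G (k + 1) \<le> G k + G (k + 2)" for k
  proof -
    have "ln (pmf R k * pmf R (k + 2)) \<le> ln ((pmf R (k + 1))\<^sup>2)"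
      using Rlc[of k] mult_pos_pos[OF Rpos Rpos] zero_less_power[OF Rpos]
      by (subst ln_le_cancel_iff) (simp_all only:)
    then show ?thesis using Rpos by (simp add: G_def ln_mult ln_realpow less_imp_neq[symmetric])
  qed
  note four = convex_four_points[of G, OF this]
  have gconv: "ennreal (G (s + a)) + ennreal (G (s + b)) \<le> ennreal (G s) + ennreal (G (s + a + b))" for s a b
    using four[of s a b] Gnn by (simp add: ennreal_plus[symmetric] del: ennreal_plus)
  define \<Phi> where "\<Phi> y = (\<integral>\<^sup>+x. ennreal (G x) \<partial>iid_sum Q y)" for y
  have entR: "mass_entropy (pmf R) = (\<integral>\<^sup>+y. \<Phi> y \<partial>poisson_pmf l)"
    by (simp add: mass_entropy_pmf R_def \<Phi>_def G_def)
  have finite_entropy: "(\<integral>\<^sup>+y. \<Phi> y \<partial>poisson_pmf l) \<noteq> \<infinity>"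
    using False entR R by simp
  then have "AE y in poisson_pmf l. \<Phi> y \<noteq> \<infinity>"
    by (intro nn_integral_noteq_infinite) auto
  then have \<Phi>fin: "\<Phi> y \<noteq> \<infinity>" for y
    using l by (simp add: AE_measure_pmf_iff)
  define \<phi> where "\<phi> y = enn2real (\<Phi> y)" for y
  have \<Phi>: "\<Phi> y = ennreal (\<phi> y)" for y
    using \<Phi>fin[of y] by (simp add: \<phi>_def less_top)
  have \<phi>nn: "\<phi> y \<ge> 0" for y by (simp add: \<phi>_def)
  have conv: "2 * \<phi> (k + 1) \<le> \<phi> k + \<phi> (k + 2)" for k
  proof -
    have "ennreal (\<phi> (k + 1)) + ennreal (\<phi> (k + 1)) \<le> ennreal (\<phi> k) + ennreal (\<phi> (k + 2))"
      unfolding \<Phi>[symmetric] \<Phi>_def by (rule nn_integral_iid_sum_convex) (rule gconv)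
    then show ?thesis using \<phi>nn by (simp add: ennreal_plus[symmetric] del: ennreal_plus)
  qed
  have int: "(\<integral>\<^sup>+y. \<Phi> y \<partial>q) = (\<Sum>y. ennreal (pmf q y * \<phi> y))" for q :: "nat pmf"
    by (simp add: nn_integral_nat_pmf \<Phi> ennreal_mult')
  have \<pi>sum: "summable (\<lambda>y. poisson_mass l y * \<phi> y)"
    using finite_entropy \<phi>nn unfolding int pois[symmetric]
    by (intro summable_suminf_not_top) auto
  have psum: "summable (\<lambda>y. pmf p y * \<phi> y)"
    by (rule summable_finite[OF fin]) (simp add: set_pmf_iff)
  have \<pi>total: "poisson_mass l sums 1"
    using pmf_sums[of "poisson_pmf l"] unfolding pois .
  have "(\<lambda>k. poisson_mass l (Suc k) * real (Suc k)) sums (l * 1)"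
    using sums_mult[OF pmf_sums[of "poisson_pmf l"], of l] poisson_mass_Suc[of _ l]
    by (simp add: pois mult.commute)
  then have \<pi>mean: "(\<lambda>k. poisson_mass l k * real k) sums l"
    using sums_Suc[of "\<lambda>k. poisson_mass l k * real k" l] by simp
  have "(\<lambda>k. pmf p k * real k) sums (\<Sum>k\<in>set_pmf p. pmf p k * real k)"
    using fin by (intro sums_finite) (auto simp: set_pmf_iff)
  also have "(\<Sum>k\<in>set_pmf p. pmf p k * real k) = l"
    using integral_measure_pmf_real[OF fin, of p real] mean by (simp add: mult.commute)
  finally have pmean: "(\<lambda>k. pmf p k * real k) sums l" .
  have le: "(\<Sum>k. pmf p k * \<phi> k) \<le> (\<Sum>k. poisson_mass l k * \<phi> k)"
    using fin l
    by (intro log_concave_ratio_convex_order[OF _ _ _ ulc pmf_sums \<pi>total pmean \<pi>mean conv \<pi>sum])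
      (auto simp: poisson_mass_def set_pmf_eq)
  have "mass_entropy (pmf (bind_pmf p (iid_sum Q))) \<le> (\<integral>\<^sup>+x. ennreal (G x) \<partial>bind_pmf p (iid_sum Q))"
    unfolding G_def by (rule gibbs_inequality[OF Rpos])
  also have "\<dots> = (\<integral>\<^sup>+y. \<Phi> y \<partial>p)"
    by (simp add: \<Phi>_def)
  also have "\<dots> = ennreal (\<Sum>y. pmf p y * \<phi> y)"
    unfolding int using \<phi>nn psum by (intro suminf_ennreal2) auto
  also have "\<dots> \<le> ennreal (\<Sum>y. poisson_mass l y * \<phi> y)"
    using le by (rule ennreal_leI)
  also have "\<dots> = (\<integral>\<^sup>+y. \<Phi> y \<partial>poisson_pmf l)"
    unfolding int pois using \<phi>nn \<pi>sum l
    by (intro suminf_ennreal2[symmetric]) (auto simp: poisson_mass_def)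
  also have "\<dots> = mass_entropy (compound (pmf Q) (poisson_mass l))"
    using entR R by simp
  finally show ?thesis .
qed simp

section \<open>Cardinality of a random independent set\<close>

text \<open>The subgraph induced on \<open>v\<close> and three pairwise nonadjacent neighbours of \<open>v\<close> is \<open>K\<^sub>1\<^sub>,\<^sub>3\<close>.\<close>
lemma claw_free_few_neighbours:
  fixes G :: "('a, 'b) pre_digraph"
  assumes G: "graph G" and cf: "claw_free G"
    and v: "v \<in> verts G" and A: "A \<subseteq> verts G" "\<forall>u\<in>A. \<forall>w\<in>A. \<not> dominates G u w"
  shows "card {a \<in> A. dominates G v a} \<le> 2"
proof (rule ccontr)
  interpret graph G by fact
  assume "\<not> ?thesis"
  then obtain T where T: "T \<subseteq> {a \<in> A. dominates G v a}" "card T = 3" "finite T"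
    using obtain_subset_with_card_n[of 3 "{a \<in> A. dominates G v a}"] by force
  define H where "H = G \<restriction> (insert v T)"
  have sub: "insert v T \<subseteq> verts G" using v A T by blast
  have vT: "v \<notin> T" using T(1) adj_not_same by blast
  have ends: "arcs_ends H = {(a, b) \<in> arcs_ends G. a \<in> insert v T \<and> b \<in> insert v T}"
    unfolding H_def arcs_ends_def arc_to_ends_def by auto
  have sym: "dominates G a v" if "a \<in> T" for a
    using that T(1) graph_symmetric by blast
  have "arcs_ends H = {v} \<times> T \<union> T \<times> {v}"
  proof (intro set_eqI)
    fix e :: "'a \<times> 'a"
    obtain a b where e: "e = (a, b)" by (cases e)
    have "\<not> dominates G v v" using adj_not_same by blast
    moreover have "\<not> dominates G a b" if "a \<in> T" "b \<in> T" using that T(1) A(2) by blast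
    moreover have "dominates G v b" if "b \<in> T" using that T(1) by blast
    ultimately show "e \<in> arcs_ends H \<longleftrightarrow> e \<in> {v} \<times> T \<union> T \<times> {v}"
      using sym vT unfolding ends e by blast
  qed
  moreover have "graph H"
    unfolding H_def
  proof -
    interpret iG: wf_digraph "G \<restriction> insert v T" by (rule wellformed_induce_subgraph)
    have "symmetric (G \<restriction> insert v T)"
      using sym_arcs induced_graph_imp_symmetric induced_induce[OF sub] by blast
    then show "graph (G \<restriction> insert v T)"
      using T(3) no_loops no_multi_arcs
      by unfold_locales (auto intro: finite_subset[OF _ finite_arcs])
  qed
  moreover have "verts H = {v} \<union> T" "{v} \<inter> T = {}" "card {v} = 1"
    using vT by (simp_all add: H_def)
  ultimately have "complete_bipartite_digraph 1 3 H"
    unfolding complete_bipartite_digraph_def using T(2) by blast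
  moreover have "induced_subgraph H G"
    unfolding H_def using sub by (rule induced_induce)
  ultimately show False using cf unfolding claw_free_def by blast
qed

lemma claw_free_relation_dominates:
  assumes "graph G" "claw_free G"
  shows "claw_free_relation (verts G) (dominates G)"
proof
  interpret graph G by fact
  show "finite (verts G)" by simp
  show "dominates G v u" if "dominates G u v" for u v
    using that graph_symmetric by blast
  show "card {a \<in> A. dominates G v a} \<le> 2"
    if "v \<in> verts G" "A \<subseteq> verts G" "\<forall>u\<in>A. \<forall>w\<in>A. \<not> dominates G u w" for v A
    using claw_free_few_neighbours[OF assms that] .
qed

definition size_pmf :: "('v, 'e) pre_digraph \<Rightarrow> nat pmf" where
  "size_pmf G = map_pmf card (pmf_of_set (independent_sets G))"

lemma empty_independent: "{} \<in> independent_sets G"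
  by (simp add: independent_sets_def)

lemma finite_independent_sets: "finite (verts G) \<Longrightarrow> finite (independent_sets G)"
  by (rule finite_subset[of _ "Pow (verts G)"]) (auto simp: independent_sets_def)

lemma pmf_size_pmf:
  assumes "finite (verts G)"
  shows "pmf (size_pmf G) k
    = real (card {S \<in> independent_sets G. card S = k}) / real (card (independent_sets G))"
proof -
  have "independent_sets G \<noteq> {}" using empty_independent[of G] by blast
  moreover have "independent_sets G \<inter> card -` {k} = {S \<in> independent_sets G. card S = k}" by blast
  ultimately show ?thesis
    unfolding size_pmf_def pmf_map using finite_independent_sets[OF assms]
    by (simp add: measure_pmf_of_set)
qed

text \<open>Dividing by the Poisson mass multiplies the number of independent \<open>k\<close>-sets by \<open>fact k / l ^ k\<close>, up to a
constant. As \<open>fact (k + 1) * fact (k - 1) * k = (fact k)\<^sup>2 * (k + 1)\<close>, this turns the inequality for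
those numbers into plain log-concavity. The support is an interval because subsets of independent sets are independent.\<close>
lemma size_pmf_ultra_log_concave:
  assumes "graph G" "claw_free G" and l: "l > 0"
  shows "log_concave (\<lambda>k. pmf (size_pmf G) k / poisson_mass l k)"
proof -
  interpret graph G by fact
  interpret C: claw_free_relation "verts G" "dominates G"
    by (rule claw_free_relation_dominates) fact+
  have indep: "C.indep = independent_sets G"
    by (simp add: C.indep_def independent_sets_def)
  define N where "N = card (independent_sets G)"
  have p: "pmf (size_pmf G) k = real (card (C.level k)) / real N" for k
    unfolding pmf_size_pmf[OF finite_verts] C.level_def indep N_def ..
  have N: "N > 0"
    using finite_independent_sets[OF finite_verts] empty_independent[of G]
    by (auto simp: N_def card_gt_0_iff)
  have pois: "poisson_mass l k > 0" for k using l by (simp add: poisson_mass_def)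
  have supp: "pmf (size_pmf G) k / poisson_mass l k \<noteq> 0 \<longleftrightarrow> C.level k \<noteq> {}" for k
    using pois[of k] N by (simp add: p C.finite_level)
  show ?thesis
    unfolding log_concave_def supp
  proof (intro conjI allI impI subsetI CollectI)
    fix i k j assume ik: "C.level i \<noteq> {} \<and> C.level k \<noteq> {}" and j: "j \<in> {i..k}"
    then obtain S where S: "S \<in> C.indep" "card S = k" by (auto simp: C.level_def)
    obtain T where "T \<subseteq> S" "card T = j"
      using obtain_subset_with_card_n[of j S] j S by auto
    then show "C.level j \<noteq> {}"
      using C.indep_subset[OF S(1)] by (auto simp: C.level_def)
  next
    fix x :: nat assume "1 \<le> x"
    then obtain n where x: "x = Suc n" by (cases x) auto
    define c0 c1 c2 where "c0 = real (card (C.level n))"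
      and "c1 = real (card (C.level (n + 1)))" and "c2 = real (card (C.level (n + 2)))"
    \<comment> \<open>The factor common to the three ratios at \<open>n\<close>, \<open>n + 1\<close> and \<open>n + 2\<close>.\<close>
    define D where "D = exp l * fact n / (real N * l ^ n)"
    have ratio: "pmf (size_pmf G) n / poisson_mass l n = D * c0"
      "pmf (size_pmf G) (n + 1) / poisson_mass l (n + 1) = D * c1 * (real (n + 1) / l)"
      "pmf (size_pmf G) (n + 2) / poisson_mass l (n + 2) = D * c2 * (real (n + 1) * real (n + 2) / l\<^sup>2)"
      using l N
      by (simp_all add: p poisson_mass_def D_def c0_def c1_def c2_def exp_minus power2_eq_square field_simps)
    have weight: "0 \<le> D\<^sup>2 * (real (n + 1) / l\<^sup>2)" by simp
    have "(real (n + 1) + 1) * (c2 * c0) \<le> real (n + 1) * c1\<^sup>2"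
      using C.level_ultra_log_concave[of "n + 1"] by (simp add: c0_def c1_def c2_def)
    from mult_left_mono[OF this weight]
    have "(D * c2 * (real (n + 1) * real (n + 2) / l\<^sup>2)) * (D * c0) \<le> (D * c1 * (real (n + 1) / l))\<^sup>2"
      using l by (simp add: power2_eq_square mult_ac add_ac)
    then show "pmf (size_pmf G) (x + 1) / poisson_mass l (x + 1) * (pmf (size_pmf G) (x - 1) / poisson_mass l (x - 1))
        \<le> (pmf (size_pmf G) x / poisson_mass l x)\<^sup>2"
      using ratio by (simp add: x)
  qed
qed

section \<open>Weight of a random independent set\<close>

lemma (in prob_space) indep_vars_sum_pmf:
  fixes X :: "'i \<Rightarrow> 'a \<Rightarrow> nat"
  assumes "finite S" "indep_vars (\<lambda>_. count_space UNIV) X S"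
    and "\<And>i. i \<in> S \<Longrightarrow> distr M (count_space UNIV) (X i) = measure_pmf Q"
  shows "prob {\<omega> \<in> space M. (\<Sum>i\<in>S. X i \<omega>) = x} = pmf (iid_sum Q (card S)) x"
  using assms
proof (induction S arbitrary: x rule: finite_induct)
  case empty
  then show ?case by (simp add: prob_space pmf_return indicator_def)
next
  case (insert j S)
  have rv: "X i \<in> measurable M (count_space UNIV)" if "i \<in> insert j S" for i
    using insert.prems(1) that by (auto simp: indep_vars_def2)
  have indS: "indep_vars (\<lambda>_. count_space UNIV) X S"
    using insert.prems(1) by (rule indep_vars_subset) auto
  have IH: "prob {\<omega> \<in> space M. (\<Sum>i\<in>S. X i \<omega>) = s} = pmf (iid_sum Q (card S)) s" for s
    using insert.IH[OF indS] insert.prems(2) by simp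
  have Xj: "prob {\<omega> \<in> space M. X j \<omega> = a} = pmf Q a" for a
  proof -
    have "pmf Q a = measure (distr M (count_space UNIV) (X j)) {a}"
      using insert.prems(2)[of j] by (simp add: pmf.rep_eq)
    also have "\<dots> = prob {\<omega> \<in> space M. X j \<omega> = a}"
      using rv[of j] by (subst measure_distr) (auto intro!: arg_cong[where f = prob])
    finally show ?thesis by simp
  qed
  have "indep_var (count_space UNIV) ((\<lambda>f. f j) \<circ> (\<lambda>\<omega>. restrict (\<lambda>i. X i \<omega>) {j}))
    (count_space UNIV) ((\<lambda>f. \<Sum>i\<in>S. f i) \<circ> (\<lambda>\<omega>. restrict (\<lambda>i. X i \<omega>) S))"
    using insert.hyps
    by (intro indep_var_compose[OF indep_var_restrict[OF insert.prems(1)]]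
        measurable_sum_nat measurable_component_singleton) auto
  then have ind: "indep_var (count_space UNIV) (X j) (count_space UNIV) (\<lambda>\<omega>. \<Sum>i\<in>S. X i \<omega>)"
    by (simp add: comp_def cong: sum.cong)
  have "prob {\<omega> \<in> space M. (\<Sum>i\<in>insert j S. X i \<omega>) = x}
    = prob (\<Union>s\<in>{..x}. {\<omega> \<in> space M. X j \<omega> = x - s} \<inter> {\<omega> \<in> space M. (\<Sum>i\<in>S. X i \<omega>) = s})"
    using insert.hyps by (intro arg_cong[where f = prob]) auto
  also have "\<dots> = (\<Sum>s\<le>x. prob ({\<omega> \<in> space M. X j \<omega> = x - s} \<inter> {\<omega> \<in> space M. (\<Sum>i\<in>S. X i \<omega>) = s}))"
    using rv by (intro finite_measure_finite_Union) (auto simp: disjoint_family_on_def)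
  also have "\<dots> = (\<Sum>s\<le>x. pmf (iid_sum Q (card S)) s * pmf Q (x - s))"
  proof (rule sum.cong)
    fix s assume "s \<in> {..x}"
    have "prob ({\<omega> \<in> space M. X j \<omega> = x - s} \<inter> {\<omega> \<in> space M. (\<Sum>i\<in>S. X i \<omega>) = s})
      = prob ((\<lambda>\<omega>. (X j \<omega>, \<Sum>i\<in>S. X i \<omega>)) -` ({x - s} \<times> {s}) \<inter> space M)"
      by (intro arg_cong[where f = prob]) auto
    also have "\<dots> = prob (X j -` {x - s} \<inter> space M) * prob ((\<lambda>\<omega>. \<Sum>i\<in>S. X i \<omega>) -` {s} \<inter> space M)"
      by (rule indep_varD[OF ind]) auto
    also have "X j -` {x - s} \<inter> space M = {\<omega> \<in> space M. X j \<omega> = x - s}" by auto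
    also have "(\<lambda>\<omega>. \<Sum>i\<in>S. X i \<omega>) -` {s} \<inter> space M = {\<omega> \<in> space M. (\<Sum>i\<in>S. X i \<omega>) = s}" by auto
    finally show "prob ({\<omega> \<in> space M. X j \<omega> = x - s} \<inter> {\<omega> \<in> space M. (\<Sum>i\<in>S. X i \<omega>) = s})
      = pmf (iid_sum Q (card S)) s * pmf Q (x - s)"
      by (simp add: Xj IH mult.commute)
  qed simp
  also have "\<dots> = pmf (iid_sum Q (Suc (card S))) x"
    by (simp only: pmf_iid_sum conv_power.simps convolve_def)
  finally show ?case using insert.hyps by simp
qed

text \<open>Conditionally on \<open>I = S\<close> the weight is a sum of \<open>card S\<close> independent variables of law \<open>Q\<close>, whose law
depends on \<open>S\<close> only through its cardinality.\<close>
lemma (in prob_space) random_index_sum_pmf: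
  fixes G :: "('v, 'e) pre_digraph" and X :: "'v \<Rightarrow> 'a \<Rightarrow> nat" and I :: "'a \<Rightarrow> 'v set"
  assumes fin: "finite (verts G)"
    and I: "I \<in> measurable M (count_space (independent_sets G))"
    and Id: "distr M (count_space (independent_sets G)) I = uniform_count_measure (independent_sets G)"
    and Xd: "\<And>i. i \<in> verts G \<Longrightarrow> distr M (count_space UNIV) (X i) = measure_pmf Q"
    and Xi: "indep_vars (\<lambda>_. count_space UNIV) X (verts G)"
    and IX: "independent_rvs M (count_space (independent_sets G)) I
           (PiM (verts G) (\<lambda>_. count_space UNIV)) (\<lambda>\<omega>. \<lambda>i\<in>verts G. X i \<omega>)"
  shows "prob {\<omega> \<in> space M. (\<Sum>i\<in>I \<omega>. X i \<omega>) = x} = pmf (bind_pmf (size_pmf G) (iid_sum Q)) x"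
proof -
  let ?J = "independent_sets G"
  let ?P = "PiM (verts G) (\<lambda>_. count_space (UNIV :: nat set))"
  have finJ: "finite ?J" and neJ: "?J \<noteq> {}"
    using finite_independent_sets[OF fin] empty_independent[of G] by auto
  have rv: "X i \<in> measurable M (count_space UNIV)" if "i \<in> verts G" for i
    using Xi that by (auto simp: indep_vars_def2)
  have IJ: "I \<omega> \<in> ?J" if "\<omega> \<in> space M" for \<omega>
    using measurable_space[OF I that] by simp
  have SV: "S \<subseteq> verts G" if "S \<in> ?J" for S using that by (simp add: independent_sets_def)
  have sumP: "(\<lambda>f. \<Sum>i\<in>S. f i) \<in> measurable ?P (count_space UNIV)" if "S \<in> ?J" for S
    using SV[OF that] by (intro measurable_sum_nat measurable_component_singleton) auto
  define A where "A S = I -` {S} \<inter> space M" for S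
  define B where "B S = {\<omega> \<in> space M. (\<Sum>i\<in>S. X i \<omega>) = x}" for S
  have AB: "prob (A S \<inter> B S) = pmf (iid_sum Q (card S)) x / real (card ?J)"
    and sets: "A S \<inter> B S \<in> events" if S: "S \<in> ?J" for S
  proof -
    let ?Y = "\<lambda>\<omega>. \<lambda>i\<in>verts G. X i \<omega>"
    let ?C = "(\<lambda>f. \<Sum>i\<in>S. f i) -` {x} \<inter> space ?P"
    have Y: "?Y \<in> measurable M ?P" using IX by (simp add: independent_rvs_def)
    have C: "?C \<in> sets ?P" using measurable_sets[OF sumP[OF S], of "{x}"] by simp
    have "(\<Sum>i\<in>S. ?Y \<omega> i) = (\<Sum>i\<in>S. X i \<omega>)" for \<omega>
      using SV[OF S] by (intro sum.cong) auto
    then have BC: "B S = ?Y -` ?C \<inter> space M"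
      using measurable_space[OF Y] by (auto simp: B_def)
    show "A S \<inter> B S \<in> events"
      using measurable_sets[OF I, of "{S}"] measurable_sets[OF Y C] S by (auto simp: A_def BC)
    have "prob (A S \<inter> B S) = prob (A S) * prob (B S)"
    proof (rule indep_setD)
      show "indep_set {I -` A \<inter> space M | A. A \<in> sets (count_space ?J)} {?Y -` B \<inter> space M | B. B \<in> sets ?P}"
        using IX by (simp add: independent_rvs_def)
      show "A S \<in> {I -` A \<inter> space M | A. A \<in> sets (count_space ?J)}"
        unfolding A_def using S by (intro CollectI exI[of _ "{S}"]) auto
      show "B S \<in> {?Y -` B \<inter> space M | B. B \<in> sets ?P}"
        unfolding BC using C by blast
    qed
    also have "prob (A S) = 1 / real (card ?J)"
    proof -
      have "prob (A S) = measure (distr M (count_space ?J) I) {S}"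
        unfolding A_def using I S by (simp add: measure_distr)
      then show ?thesis
        unfolding Id using finJ S by (simp add: measure_uniform_count_measure)
    qed
    also have "prob (B S) = pmf (iid_sum Q (card S)) x"
      unfolding B_def using finite_subset[OF SV[OF S] fin] SV[OF S] Xd
      by (intro indep_vars_sum_pmf indep_vars_subset[OF Xi]) auto
    finally show "prob (A S \<inter> B S) = pmf (iid_sum Q (card S)) x / real (card ?J)" by simp
  qed
  have "{\<omega> \<in> space M. (\<Sum>i\<in>I \<omega>. X i \<omega>) = x} = (\<Union>S\<in>?J. A S \<inter> B S)"
    using IJ by (auto simp: A_def B_def)
  also have "prob \<dots> = (\<Sum>S\<in>?J. prob (A S \<inter> B S))"
    using finJ sets by (intro finite_measure_finite_Union) (auto simp: disjoint_family_on_def A_def)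
  also have "\<dots> = (\<Sum>S\<in>?J. pmf (iid_sum Q (card S)) x) / real (card ?J)"
    by (simp add: AB sum_divide_distrib)
  also have "\<dots> = pmf (bind_pmf (size_pmf G) (iid_sum Q)) x"
    unfolding size_pmf_def bind_map_pmf using neJ finJ by (simp add: pmf_bind_pmf_of_set)
  finally show ?thesis .
qed

theorem corollary6p2:
  fixes G :: "('v, 'e) pre_digraph"
    and Q :: "nat pmf"
    and M :: "'w measure"
    and I :: "'w \<Rightarrow> 'v set"
    and X :: "'v \<Rightarrow> 'w \<Rightarrow> nat"
    and W :: "'w \<Rightarrow> nat"
    and l :: real
  assumes "graph G" and "claw_free G"
    and "prob_space M"
    and "I \<in> measurable M (count_space (independent_sets G))"
    and "distr M (count_space (independent_sets G)) I = uniform_count_measure (independent_sets G)"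
    and "l = prob_space.expectation M (\<lambda>\<omega>. real (card (I \<omega>)))"
    and "pmf Q 0 = 0" and "log_concave (pmf Q)"
    and "pmf Q 1 > 0" and "l * (pmf Q 1)\<^sup>2 \<ge> 2 * pmf Q 2"
    and "\<And>i. i \<in> verts G \<Longrightarrow> X i \<in> measurable M (count_space UNIV)"
    and "\<And>i. i \<in> verts G \<Longrightarrow> distr M (count_space UNIV) (X i) = measure_pmf Q"
    and "prob_space.indep_vars M (\<lambda>_. count_space UNIV) X (verts G)"
    and "independent_rvs M
           (count_space (independent_sets G)) I
           (PiM (verts G) (\<lambda>_. count_space UNIV)) (\<lambda>\<omega>. \<lambda>i\<in>verts G. X i \<omega>)"
    and "\<And>\<omega>. \<omega> \<in> space M \<Longrightarrow> W \<omega> = (\<Sum>i\<in>I \<omega>. X i \<omega>)"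
  shows "mass_entropy (\<lambda>x. \<P>(\<omega> in M. W \<omega> = x))
           \<le> mass_entropy (compound (pmf Q) (poisson_mass l))"
proof -
  interpret graph G by fact
  interpret prob_space M by fact
  let ?J = "independent_sets G"
  have finJ: "finite ?J" and neJ: "?J \<noteq> {}"
    using finite_independent_sets[OF finite_verts] empty_independent[of G] by auto
  have "prob {\<omega> \<in> space M. W \<omega> = x} = prob {\<omega> \<in> space M. (\<Sum>i\<in>I \<omega>. X i \<omega>) = x}" for x
    using assms(15) by (intro arg_cong[where f = prob]) auto
  also have "\<dots> x = pmf (bind_pmf (size_pmf G) (iid_sum Q)) x" for x
    using assms(4,5,12,13,14) by (intro random_index_sum_pmf) auto
  finally have W: "(\<lambda>x. \<P>(\<omega> in M. W \<omega> = x)) = pmf (bind_pmf (size_pmf G) (iid_sum Q))"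
    by (intro ext)
  have "l = (\<integral>S. real (card S) \<partial>distr M (count_space ?J) I)"
    unfolding assms(6) by (rule integral_distr[OF assms(4), symmetric]) simp
  then have l: "l = (\<Sum>S\<in>?J. real (card S)) / real (card ?J)"
    unfolding assms(5) using finJ by (simp add: integral_uniform_count_measure)
  have mean: "measure_pmf.expectation (size_pmf G) real = l"
    unfolding size_pmf_def integral_map_pmf l using neJ finJ by (simp add: integral_pmf_of_set)
  have set: "set_pmf (size_pmf G) = card ` ?J"
    unfolding size_pmf_def using neJ finJ by simp
  show ?thesis
  proof (cases "l = 0")
    case False
    moreover have "l \<ge> 0" unfolding l by (intro divide_nonneg_nonneg sum_nonneg) auto
    ultimately have lpos: "l > 0" by simp
    show ?thesis
      unfolding W using assms(7-10) lpos finJ mean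
        size_pmf_ultra_log_concave[OF assms(1,2) lpos]
      by (intro compound_entropy_le) (auto simp: set)
  next
    case True
    \<comment> \<open>Now the only independent set is empty and the weight is \<open>0\<close>, so its entropy vanishes.\<close>
    then have "(\<Sum>S\<in>?J. real (card S)) = 0"
      using l neJ finJ by simp
    then have "card S = 0" if "S \<in> ?J" for S
      using that finJ by (subst (asm) sum_nonneg_eq_0_iff) auto
    then have "size_pmf G = return_pmf 0"
      unfolding set_pmf_subset_singleton[symmetric] set by auto
    then have "pmf (bind_pmf (size_pmf G) (iid_sum Q)) = (\<lambda>x. if x = 0 then 1 else 0)"
      by (auto simp: bind_return_pmf pmf_return)
    then have "mass_entropy (pmf (bind_pmf (size_pmf G) (iid_sum Q))) = 0"
      by (simp add: mass_entropy_def if_distrib[of ln] cong: if_cong)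
    then show ?thesis unfolding W by simp
  qed
qed

end
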